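(* Let $k$ and $j$ be some arbitrary iterates of Algorithms PD-PMM and SSN, respectively. Then the eigenvalues of $\widetilde M_{k_j}^{-1}\widehat M_{k_j}$ lie in the union of the intervals $$I_-:=\left[-\beta_H-\sqrt{\beta_{NE}},\,-\alpha_H\right],\qquad I_+:=\left[\frac{1}{1+\beta_H},\,1+\sqrt{\beta_{NE}-1}\right].$$
   Context: Problem data: $c \in \mathbb{R}^n$, $Q \in \mathbb{R}^{n\times n}$ symmetric positive semidefinite, $A \in \mathbb{R}^{m\times n}$ with $m \le n$, $b\in\mathbb{R}^m$, $g(x)=\|Dx\|_1$ with $D\in\mathbb{R}^{n\times n}$ diagonal and positive semidefinite, and $\mathcal{K}=\{x\in\mathbb{R}^n : a_l\le x\le a_u\}$ where $a_l\le a_u$ are vectors whose entries may be infinite. $\delta_{\mathcal K}$ is the indicator function of $\mathcal{K}$, $^*$ on a function denotes the Fenchel conjugate, $\Pi_{\mathcal{C}}$ is Euclidean projection, $\|\cdot\|$ the Euclidean norm, $\mathrm{dist}$ the Euclidean distance, $\partial$ the convex subdifferential, and $\mathbf{prox}_p(u)=\arg\min_x\{p(x)+\frac12\|u-x\|^2\}$. Standing assumption: the problem (P) $\min_x c^\top x+\frac12x^\top Qx+g(x)+\delta_{\mathcal{K}}(x)$ s.t. $Ax=b$, and its dual (D) $\max_{x,y,z} b^\top y-\frac12x^\top Qx-\delta^*_{\mathcal{K}}(z)-g^*(A^\top y-c-Qx-z)$, are both feasible. Algorithm PD-PMM. Input: $(x_0,y_0,z_0)\in\mathbb{R}^n\times\mathbb{R}^m\times\mathbb{R}^n$;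 positive non-increasing $\{\tau_k\}$ with limit $\tau_\infty>0$; non-decreasing $\{\beta_k\}$ with $\beta_0>0$, $\beta_k\nearrow\beta_\infty\le\infty$; $\rho_k=\beta_k/\tau_k$; positive tolerances $\epsilon_k\to0$. For each $k\ge 0$, find $(x_{k+1},y_{k+1})$ with $\mathrm{dist}(0,F_{\beta_k,\rho_k}(x_{k+1},y_{k+1}))\le\epsilon_k$ and set $z_{k+1}=(z_k+\beta_kx_{k+1})-\beta_k\Pi_{\mathcal{K}}(\beta_k^{-1}z_k+x_{k+1})$, where $r_{\beta_k,\rho_k}(x,y)=c+Qx-A^\top y+(z_k+\beta_kx)-\beta_k\Pi_{\mathcal{K}}(\beta_k^{-1}z_k+x)+\rho_k^{-1}(x-x_k)$ and $F_{\beta_k,\rho_k}(x,y)=\{(u',v'):u'\in r_{\beta_k,\rho_k}(x,y)+\partial g(x),\ v'=Ax+\beta_k^{-1}(y-y_k)-b\}$. Algorithm SSN (semismooth Newton, inner method for the $k$-th sub-problem). Fix $\zeta_k>0$, $\mu\in(0,\frac12)$, $\delta\in(0,1)$, $\eta_j\in(0,1)$, and start from $(x_{k_0},y_{k_0})=(x_k,y_k)$. With $$\widehat F(x,y)=\begin{bmatrix}x-\mathbf{prox}_{\zeta_kg}(x-\zeta_kr_{\beta_k,\rho_k}(x,y))\\ \zeta_k(Ax+\beta_k^{-1}(y-y_k)-b)\end{bmatrix},$$ at iteration $j$ find $(d_x,d_y)$ with $\|M_{k_j}(d_x,d_y)+\widehat F(x_{k_j},y_{k_j})\|\le\eta_j\|\widehat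 F(x_{k_j},y_{k_j})\|$, where $$M_{k_j}=\begin{bmatrix}(I_n-\widehat B_{k_j})+\zeta_k\widehat B_{k_j}H_{k_j}&-\zeta_k\widehat B_{k_j}A^\top\\ \zeta_kA&\zeta_k\beta_k^{-1}I_m\end{bmatrix},$$ and set $(x_{k_{j+1}},y_{k_{j+1}})=(x_{k_j},y_{k_j})+\alpha_j(d_x,d_y)$ with $\alpha_j=\delta^{m_j}$, $m_j$ the first non-negative integer such that $\Theta((x_{k_j},y_{k_j})+\delta^{m_j}(d_x,d_y))\le(1-2\mu\delta^{m_j})\Theta(x_{k_j},y_{k_j})$, $\Theta=\|\widehat F\|^2$; the iterations stop when $\mathrm{dist}(0,F_{\beta_k,\rho_k})\le\epsilon_k$ is met. Matrices at inner-outer iteration $k_j$. Let $\widehat u_{k_j}=x_{k_j}-\zeta_kr_{\beta_k,\rho_k}(x_{k_j},y_{k_j})$. $B_{k_j}$ and $\widehat B_{k_j}$ are the diagonal $n\times n$ matrices with: $B_{k_j,(i,i)}=1$ if $\beta_k^{-1}z_{k,i}+x_{k_j,i}\in(a_{l_i},a_{u_i})$ and $0$ otherwise; $\widehat B_{k_j,(i,i)}=1$ if $|\widehat u_{k_j,i}|>\zeta_kD_{(i,i)}$ or $D_{(i,i)}=0$, and $0$ otherwise. Put $$H_{k_j}=Q+(\beta_k+\rho_k^{-1})I_n-\beta_kB_{k_j},\qquad\widehat{\mathcal{B}}_j=\{i:\widehat B_{k_j,(i,i)}=1\}.$$ $A_{\widehat{\mathcal{B}}_j}$ denotes the columns of $A$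 with indices in $\widehat{\mathcal{B}}_j$, and $H_{k_j,(\widehat{\mathcal{B}}_j,\widehat{\mathcal{B}}_j)}$ the corresponding principal submatrix of $H_{k_j}$. Let $\widetilde H_{k_j,(\widehat{\mathcal{B}}_j,\widehat{\mathcal{B}}_j)}$ be the diagonal matrix with the same diagonal as $H_{k_j,(\widehat{\mathcal{B}}_j,\widehat{\mathcal{B}}_j)}$, and let $E_{k_j}$ be the $|\widehat{\mathcal{B}}_j|\times|\widehat{\mathcal{B}}_j|$ diagonal matrix whose entry at the position of index $i\in\widehat{\mathcal{B}}_j$ is the reciprocal of the corresponding diagonal entry of $\widetilde H_{k_j,(\widehat{\mathcal{B}}_j,\widehat{\mathcal{B}}_j)}$ if $\beta_k^{-1}z_{k,i}+x_{k_j,i}\in(a_{l_i},a_{u_i})$, and $0$ otherwise. Define $$\widehat S_{k_j}=A_{\widehat{\mathcal{B}}_j}\widetilde H_{k_j,(\widehat{\mathcal{B}}_j,\widehat{\mathcal{B}}_j)}^{-1}A_{\widehat{\mathcal{B}}_j}^\top+\beta_k^{-1}I_m,\qquad\widetilde S_{k_j}=A_{\widehat{\mathcal{B}}_j}E_{k_j}A_{\widehat{\mathcal{B}}_j}^\top+\beta_k^{-1}I_m,$$ the reduced Newton matrix and its preconditioner $$\widehat M_{k_j}=\begin{bmatrix}-H_{k_j,(\widehat{\mathcal{B}}_j,\widehat{\mathcal{B}}_j)}&A_{\widehat{\mathcal{B}}_j}^\top\\ A_{\widehat{\mathcal{B}}_j}&\beta_k^{-1}I_m\end{bmatrix},\qquad\widetilde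 M_{k_j}=\begin{bmatrix}\widetilde H_{k_j,(\widehat{\mathcal{B}}_j,\widehat{\mathcal{B}}_j)}&0\\ 0&\widetilde S_{k_j}\end{bmatrix},$$ and $$\bar S_{k_j}=\widetilde S_{k_j}^{-1/2}\widehat S_{k_j}\widetilde S_{k_j}^{-1/2},\qquad\bar H_{k_j}=\widetilde H_{k_j,(\widehat{\mathcal{B}}_j,\widehat{\mathcal{B}}_j)}^{-1/2}H_{k_j,(\widehat{\mathcal{B}}_j,\widehat{\mathcal{B}}_j)}\widetilde H_{k_j,(\widehat{\mathcal{B}}_j,\widehat{\mathcal{B}}_j)}^{-1/2}.$$ Finally $\beta_{NE}=\lambda_{\max}(\bar S_{k_j})$, $\alpha_H=\lambda_{\min}(\bar H_{k_j})$, $\beta_H=\lambda_{\max}(\bar H_{k_j})$, where $\lambda_{\min},\lambda_{\max}$ denote the smallest and largest eigenvalue. *)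

theory Defs
  imports
    "HOL-Library.Extended_Real"
    "Jordan_Normal_Form.Spectral_Radius"
    "Jordan_Normal_Form.Gauss_Jordan_Elimination"
    "Jordan_Normal_Form.DL_Submatrix"
begin

text \<open>Vectors and matrices are those of the AFP entry Jordan Normal Form, so \<open>\<real>\<^sup>n\<close> is
  \<^term>\<open>carrier_vec n\<close> and indices run over \<open>0, \<dots>, n - 1\<close>.\<close>

section \<open>Euclidean and convex-analytic notions on \<open>\<real>\<^sup>n\<close>\<close>

definition vnorm :: "real vec \<Rightarrow> real" where
  "vnorm v = sqrt (v \<bullet> v)"

definition dist0 :: "real vec set \<Rightarrow> real" where
  "dist0 S = (INF w\<in>S. vnorm w)"

definition proj :: "real vec set \<Rightarrow> real vec \<Rightarrow> real vec" where
  "proj C u = arg_min_on (\<lambda>x. vnorm (u - x)) C"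

definition prox :: "nat \<Rightarrow> (real vec \<Rightarrow> real) \<Rightarrow> real vec \<Rightarrow> real vec" where
  "prox n p u = arg_min_on (\<lambda>x. p x + 1/2 * (vnorm (u - x))\<^sup>2) (carrier_vec n)"

definition subdiff :: "nat \<Rightarrow> (real vec \<Rightarrow> real) \<Rightarrow> real vec \<Rightarrow> real vec set" where
  "subdiff n p x = {s \<in> carrier_vec n. \<forall>w\<in>carrier_vec n. p w \<ge> p x + s \<bullet> (w - x)}"

definition delta :: "real vec set \<Rightarrow> real vec \<Rightarrow> ereal" where
  "delta C x = (if x \<in> C then 0 else \<infinity>)"

definition fconj :: "nat \<Rightarrow> (real vec \<Rightarrow> ereal) \<Rightarrow> real vec \<Rightarrow> ereal" where
  "fconj n f u = (SUP x\<in>carrier_vec n. ereal (u \<bullet> x) - f x)"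


section \<open>Matrix notions\<close>

definition sym_psd :: "nat \<Rightarrow> real mat \<Rightarrow> bool" where
  "sym_psd n M \<longleftrightarrow> M \<in> carrier_mat n n \<and> transpose_mat M = M \<and>
     (\<forall>v\<in>carrier_vec n. 0 \<le> v \<bullet> (M *\<^sub>v v))"

definition minv :: "real mat \<Rightarrow> real mat" where
  "minv M = the (mat_inverse M)"

text \<open>A symmetric positive semidefinite matrix has exactly one symmetric positive semidefinite
  square root, so the choice below is determined for such matrices.\<close>

definition mat_sqrt :: "real mat \<Rightarrow> real mat" where
  "mat_sqrt M = (SOME R. sym_psd (dim_row M) R \<and> R * R = M)"

definition minv_sqrt :: "real mat \<Rightarrow> real mat" where
  "minv_sqrt M = minv (mat_sqrt M)"

text \<open>Smallest and largest (real) eigenvalue; used for symmetric matrices only.  The matrix of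
  size 0 has no eigenvalues; both are 0 there by convention.\<close>

definition lam_min :: "real mat \<Rightarrow> real" where
  "lam_min M = (if dim_row M = 0 then 0 else Min (spectrum M))"

definition lam_max :: "real mat \<Rightarrow> real" where
  "lam_max M = (if dim_row M = 0 then 0 else Max (spectrum M))"


section \<open>Problem data\<close>

record qp =
  nvar :: nat
  ncon :: nat
  cvec :: "real vec"
  Qmat :: "real mat"
  Amat :: "real mat"
  bvec :: "real vec"
  Dmat :: "real mat"
  lower :: "ereal vec"
  upper :: "ereal vec"

definition gfun :: "'r qp_scheme \<Rightarrow> real vec \<Rightarrow> real" where
  "gfun P x = (\<Sum>i<nvar P. \<bar>(Dmat P *\<^sub>v x) $ i\<bar>)"

definition box :: "'r qp_scheme \<Rightarrow> real vec set" where
  "box P = {x \<in> carrier_vec (nvar P).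
     \<forall>i<nvar P. lower P $ i \<le> ereal (x $ i) \<and> ereal (x $ i) \<le> upper P $ i}"

definition primal_obj :: "'r qp_scheme \<Rightarrow> real vec \<Rightarrow> ereal" where
  "primal_obj P x = ereal (cvec P \<bullet> x + 1/2 * (x \<bullet> (Qmat P *\<^sub>v x)) + gfun P x) + delta (box P) x"

definition dual_obj :: "'r qp_scheme \<Rightarrow> real vec \<Rightarrow> real vec \<Rightarrow> real vec \<Rightarrow> ereal" where
  "dual_obj P x y z =
     ereal (bvec P \<bullet> y - 1/2 * (x \<bullet> (Qmat P *\<^sub>v x)))
     - fconj (nvar P) (delta (box P)) z
     - fconj (nvar P) (\<lambda>w. ereal (gfun P w))
         (transpose_mat (Amat P) *\<^sub>v y - cvec P - Qmat P *\<^sub>v x - z)"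

definition primal_feasible :: "'r qp_scheme \<Rightarrow> bool" where
  "primal_feasible P \<longleftrightarrow>
     (\<exists>x\<in>carrier_vec (nvar P). Amat P *\<^sub>v x = bvec P \<and> primal_obj P x < \<infinity>)"

definition dual_feasible :: "'r qp_scheme \<Rightarrow> bool" where
  "dual_feasible P \<longleftrightarrow>
     (\<exists>x\<in>carrier_vec (nvar P). \<exists>y\<in>carrier_vec (ncon P). \<exists>z\<in>carrier_vec (nvar P).
        dual_obj P x y z > -\<infinity>)"

definition qp_problem :: "'r qp_scheme \<Rightarrow> bool" where
  "qp_problem P \<longleftrightarrow>
     ncon P \<le> nvar P \<and>
     cvec P \<in> carrier_vec (nvar P) \<and>
     sym_psd (nvar P) (Qmat P) \<and>
     Amat P \<in> carrier_mat (ncon P) (nvar P) \<and>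
     bvec P \<in> carrier_vec (ncon P) \<and>
     diagonal_mat (Dmat P) \<and> sym_psd (nvar P) (Dmat P) \<and>
     lower P \<in> carrier_vec (nvar P) \<and> upper P \<in> carrier_vec (nvar P) \<and>
     (\<forall>i<nvar P. lower P $ i \<le> upper P $ i) \<and>
     primal_feasible P \<and> dual_feasible P"


section \<open>Algorithm PD-PMM\<close>

text \<open>A sub-problem is the problem data together with
  \<open>\<beta>\<^sub>k\<close>, \<open>\<rho>\<^sub>k\<close>, \<open>x\<^sub>k\<close>, \<open>y\<^sub>k\<close>, \<open>z\<^sub>k\<close>.\<close>

record subproblem = qp +
  beta :: real
  rho :: real
  xcen :: "real vec"
  ycen :: "real vec"
  zcen :: "real vec"

definition proj_residual :: "subproblem \<Rightarrow> real vec \<Rightarrow> real vec" where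
  "proj_residual S x =
     (zcen S + beta S \<cdot>\<^sub>v x) - beta S \<cdot>\<^sub>v proj (box S) (inverse (beta S) \<cdot>\<^sub>v zcen S + x)"

definition rvec :: "subproblem \<Rightarrow> real vec \<Rightarrow> real vec \<Rightarrow> real vec" where
  "rvec S x y =
     cvec S + Qmat S *\<^sub>v x - transpose_mat (Amat S) *\<^sub>v y + proj_residual S x
     + inverse (rho S) \<cdot>\<^sub>v (x - xcen S)"

definition con_residual :: "subproblem \<Rightarrow> real vec \<Rightarrow> real vec \<Rightarrow> real vec" where
  "con_residual S x y = Amat S *\<^sub>v x + inverse (beta S) \<cdot>\<^sub>v (y - ycen S) - bvec S"

text \<open>Pairs \<open>(u, v) \<in> \<real>\<^sup>n \<times> \<real>\<^sup>m\<close> are stacked into a vector of \<open>\<real>\<^bsup>n+m\<^esup>\<close>.\<close>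

definition Fset :: "subproblem \<Rightarrow> real vec \<Rightarrow> real vec \<Rightarrow> real vec set" where
  "Fset S x y = {(rvec S x y + s) @\<^sub>v con_residual S x y | s. s \<in> subdiff (nvar S) (gfun S) x}"

definition pmm_inputs ::
  "(nat \<Rightarrow> real) \<Rightarrow> real \<Rightarrow> (nat \<Rightarrow> real) \<Rightarrow> ereal \<Rightarrow> (nat \<Rightarrow> real) \<Rightarrow> bool" where
  "pmm_inputs \<tau> \<tau>inf \<beta> \<beta>inf \<epsilon> \<longleftrightarrow>
     (\<forall>k. 0 < \<tau> k) \<and> decseq \<tau> \<and> \<tau> \<longlonglongrightarrow> \<tau>inf \<and> 0 < \<tau>inf \<and>
     0 < \<beta> 0 \<and> incseq \<beta> \<and> (\<lambda>k. ereal (\<beta> k)) \<longlonglongrightarrow> \<beta>inf \<and>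
     (\<forall>k. 0 < \<epsilon> k) \<and> \<epsilon> \<longlonglongrightarrow> 0"

definition pmm_sub ::
  "qp \<Rightarrow> (nat \<Rightarrow> real) \<Rightarrow> (nat \<Rightarrow> real) \<Rightarrow> (nat \<Rightarrow> real vec) \<Rightarrow> (nat \<Rightarrow> real vec) \<Rightarrow>
    (nat \<Rightarrow> real vec) \<Rightarrow> nat \<Rightarrow> subproblem" where
  "pmm_sub P \<tau> \<beta> x y z k = qp.extend P (subproblem.fields (\<beta> k) (\<beta> k / \<tau> k) (x k) (y k) (z k))"

text \<open>The first \<open>k\<close> iterations have been carried out; entries of the sequences beyond index
  \<open>k\<close> are irrelevant.\<close>

definition pmm_iterates ::
  "qp \<Rightarrow> (nat \<Rightarrow> real) \<Rightarrow> (nat \<Rightarrow> real) \<Rightarrow> (nat \<Rightarrow> real) \<Rightarrow> (nat \<Rightarrow> real vec) \<Rightarrow>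
    (nat \<Rightarrow> real vec) \<Rightarrow> (nat \<Rightarrow> real vec) \<Rightarrow> nat \<Rightarrow> bool" where
  "pmm_iterates P \<tau> \<beta> \<epsilon> x y z k \<longleftrightarrow>
     x 0 \<in> carrier_vec (nvar P) \<and> y 0 \<in> carrier_vec (ncon P) \<and> z 0 \<in> carrier_vec (nvar P) \<and>
     (\<forall>i<k. x (Suc i) \<in> carrier_vec (nvar P) \<and> y (Suc i) \<in> carrier_vec (ncon P) \<and>
        dist0 (Fset (pmm_sub P \<tau> \<beta> x y z i) (x (Suc i)) (y (Suc i))) \<le> \<epsilon> i \<and>
        z (Suc i) = proj_residual (pmm_sub P \<tau> \<beta> x y z i) (x (Suc i)))"


section \<open>Algorithm SSN\<close>

definition inside :: "subproblem \<Rightarrow> real vec \<Rightarrow> nat \<Rightarrow> bool" where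
  "inside S x i \<longleftrightarrow>
     lower S $ i < ereal (inverse (beta S) * zcen S $ i + x $ i) \<and>
     ereal (inverse (beta S) * zcen S $ i + x $ i) < upper S $ i"

definition Bmat :: "subproblem \<Rightarrow> real vec \<Rightarrow> real mat" where
  "Bmat S x = mat_diag (nvar S) (\<lambda>i. if inside S x i then 1 else 0)"

definition uhat :: "subproblem \<Rightarrow> real \<Rightarrow> real vec \<Rightarrow> real vec \<Rightarrow> real vec" where
  "uhat S \<zeta> x y = x - \<zeta> \<cdot>\<^sub>v rvec S x y"

definition Bhat :: "subproblem \<Rightarrow> real \<Rightarrow> real vec \<Rightarrow> real vec \<Rightarrow> real mat" where
  "Bhat S \<zeta> x y = mat_diag (nvar S)
     (\<lambda>i. if \<bar>uhat S \<zeta> x y $ i\<bar> > \<zeta> * Dmat S $$ (i,i) \<or> Dmat S $$ (i,i) = 0 then 1 else 0)"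

definition Hmat :: "subproblem \<Rightarrow> real vec \<Rightarrow> real mat" where
  "Hmat S x = Qmat S + (beta S + inverse (rho S)) \<cdot>\<^sub>m 1\<^sub>m (nvar S) - beta S \<cdot>\<^sub>m Bmat S x"

definition Fhat :: "subproblem \<Rightarrow> real \<Rightarrow> real vec \<Rightarrow> real vec \<Rightarrow> real vec" where
  "Fhat S \<zeta> x y =
     (x - prox (nvar S) (\<lambda>w. \<zeta> * gfun S w) (x - \<zeta> \<cdot>\<^sub>v rvec S x y)) @\<^sub>v
     (\<zeta> \<cdot>\<^sub>v con_residual S x y)"

definition Theta :: "subproblem \<Rightarrow> real \<Rightarrow> real vec \<Rightarrow> real vec \<Rightarrow> real" where
  "Theta S \<zeta> x y = (vnorm (Fhat S \<zeta> x y))\<^sup>2"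

definition Newton_mat :: "subproblem \<Rightarrow> real \<Rightarrow> real vec \<Rightarrow> real vec \<Rightarrow> real mat" where
  "Newton_mat S \<zeta> x y =
     four_block_mat
       ((1\<^sub>m (nvar S) - Bhat S \<zeta> x y) + \<zeta> \<cdot>\<^sub>m (Bhat S \<zeta> x y * Hmat S x))
       (- (\<zeta> \<cdot>\<^sub>m (Bhat S \<zeta> x y * transpose_mat (Amat S))))
       (\<zeta> \<cdot>\<^sub>m Amat S)
       ((\<zeta> * inverse (beta S)) \<cdot>\<^sub>m 1\<^sub>m (ncon S))"

definition sufficient_decrease ::
  "subproblem \<Rightarrow> real \<Rightarrow> real \<Rightarrow> real vec \<Rightarrow> real vec \<Rightarrow> real vec \<Rightarrow> real vec \<Rightarrow> real \<Rightarrow> bool" where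
  "sufficient_decrease S \<zeta> \<mu> x y dx dy \<alpha> \<longleftrightarrow>
     Theta S \<zeta> (x + \<alpha> \<cdot>\<^sub>v dx) (y + \<alpha> \<cdot>\<^sub>v dy) \<le> (1 - 2 * \<mu> * \<alpha>) * Theta S \<zeta> x y"

definition ssn_step ::
  "subproblem \<Rightarrow> real \<Rightarrow> real \<Rightarrow> real \<Rightarrow> real \<Rightarrow> real vec \<Rightarrow> real vec \<Rightarrow> real vec \<Rightarrow> real vec \<Rightarrow> bool" where
  "ssn_step S \<zeta> \<mu> \<delta> \<eta> x y x' y' \<longleftrightarrow>
     (\<exists>dx\<in>carrier_vec (nvar S). \<exists>dy\<in>carrier_vec (ncon S). \<exists>l::nat.
        vnorm (Newton_mat S \<zeta> x y *\<^sub>v (dx @\<^sub>v dy) + Fhat S \<zeta> x y) \<le> \<eta> * vnorm (Fhat S \<zeta> x y) \<and>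
        sufficient_decrease S \<zeta> \<mu> x y dx dy (\<delta> ^ l) \<and>
        (\<forall>l'<l. \<not> sufficient_decrease S \<zeta> \<mu> x y dx dy (\<delta> ^ l')) \<and>
        x' = x + \<delta> ^ l \<cdot>\<^sub>v dx \<and> y' = y + \<delta> ^ l \<cdot>\<^sub>v dy)"

text \<open>The first \<open>j\<close> inner iterations have been carried out, i.e. the stopping test failed at
  the iterates before the \<open>j\<close>-th one.\<close>

definition ssn_iterates ::
  "subproblem \<Rightarrow> real \<Rightarrow> real \<Rightarrow> real \<Rightarrow> real \<Rightarrow> (nat \<Rightarrow> real) \<Rightarrow>
    (nat \<Rightarrow> real vec) \<Rightarrow> (nat \<Rightarrow> real vec) \<Rightarrow> nat \<Rightarrow> bool" where
  "ssn_iterates S \<epsilon> \<zeta> \<mu> \<delta> \<eta> xs ys j \<longleftrightarrow>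
     xs 0 = xcen S \<and> ys 0 = ycen S \<and>
     (\<forall>i<j. \<not> dist0 (Fset S (xs i) (ys i)) \<le> \<epsilon> \<and>
        ssn_step S \<zeta> \<mu> \<delta> (\<eta> i) (xs i) (ys i) (xs (Suc i)) (ys (Suc i)))"


section \<open>Reduced Newton matrix and preconditioner\<close>

definition Bset :: "subproblem \<Rightarrow> real \<Rightarrow> real vec \<Rightarrow> real vec \<Rightarrow> nat set" where
  "Bset S \<zeta> x y = {i. i < nvar S \<and> Bhat S \<zeta> x y $$ (i,i) = 1}"

definition A_B :: "subproblem \<Rightarrow> real \<Rightarrow> real vec \<Rightarrow> real vec \<Rightarrow> real mat" where
  "A_B S \<zeta> x y = submatrix (Amat S) {..<ncon S} (Bset S \<zeta> x y)"

definition H_BB :: "subproblem \<Rightarrow> real \<Rightarrow> real vec \<Rightarrow> real vec \<Rightarrow> real mat" where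
  "H_BB S \<zeta> x y = submatrix (Hmat S x) (Bset S \<zeta> x y) (Bset S \<zeta> x y)"

definition Htil :: "subproblem \<Rightarrow> real \<Rightarrow> real vec \<Rightarrow> real vec \<Rightarrow> real mat" where
  "Htil S \<zeta> x y = mat_diag (card (Bset S \<zeta> x y)) (\<lambda>p. H_BB S \<zeta> x y $$ (p,p))"

text \<open>Position \<open>p\<close> of a reduced matrix belongs to the index \<^term>\<open>pick (Bset S \<zeta> x y) p\<close>, the
  \<open>p\<close>-th smallest element of the index set.\<close>

definition Emat :: "subproblem \<Rightarrow> real \<Rightarrow> real vec \<Rightarrow> real vec \<Rightarrow> real mat" where
  "Emat S \<zeta> x y = mat_diag (card (Bset S \<zeta> x y))
     (\<lambda>p. if inside S x (pick (Bset S \<zeta> x y) p) then inverse (Htil S \<zeta> x y $$ (p,p)) else 0)"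

definition Shat :: "subproblem \<Rightarrow> real \<Rightarrow> real vec \<Rightarrow> real vec \<Rightarrow> real mat" where
  "Shat S \<zeta> x y =
     A_B S \<zeta> x y * minv (Htil S \<zeta> x y) * transpose_mat (A_B S \<zeta> x y)
     + inverse (beta S) \<cdot>\<^sub>m 1\<^sub>m (ncon S)"

definition Stil :: "subproblem \<Rightarrow> real \<Rightarrow> real vec \<Rightarrow> real vec \<Rightarrow> real mat" where
  "Stil S \<zeta> x y =
     A_B S \<zeta> x y * Emat S \<zeta> x y * transpose_mat (A_B S \<zeta> x y)
     + inverse (beta S) \<cdot>\<^sub>m 1\<^sub>m (ncon S)"

definition Mhat :: "subproblem \<Rightarrow> real \<Rightarrow> real vec \<Rightarrow> real vec \<Rightarrow> real mat" where
  "Mhat S \<zeta> x y =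
     four_block_mat (- H_BB S \<zeta> x y) (transpose_mat (A_B S \<zeta> x y))
                    (A_B S \<zeta> x y) (inverse (beta S) \<cdot>\<^sub>m 1\<^sub>m (ncon S))"

definition Mtil :: "subproblem \<Rightarrow> real \<Rightarrow> real vec \<Rightarrow> real vec \<Rightarrow> real mat" where
  "Mtil S \<zeta> x y =
     four_block_mat (Htil S \<zeta> x y) (0\<^sub>m (card (Bset S \<zeta> x y)) (ncon S))
                    (0\<^sub>m (ncon S) (card (Bset S \<zeta> x y))) (Stil S \<zeta> x y)"

definition Sbar :: "subproblem \<Rightarrow> real \<Rightarrow> real vec \<Rightarrow> real vec \<Rightarrow> real mat" where
  "Sbar S \<zeta> x y = minv_sqrt (Stil S \<zeta> x y) * Shat S \<zeta> x y * minv_sqrt (Stil S \<zeta> x y)"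

definition Hbar :: "subproblem \<Rightarrow> real \<Rightarrow> real vec \<Rightarrow> real vec \<Rightarrow> real mat" where
  "Hbar S \<zeta> x y = minv_sqrt (Htil S \<zeta> x y) * H_BB S \<zeta> x y * minv_sqrt (Htil S \<zeta> x y)"

end

theory Submission imports Defs begin

text \<open>Let \<open>P = diag(Htil, Stil)\<^bsup>-1/2\<^esup>\<close>. The preconditioned matrix is similar to the symmetric matrix
  \<open>P Mhat P = ((- Hbar, R\<^sup>T), (R, T))\<close>, where \<open>R = Stil\<^bsup>-1/2\<^esup> A Htil\<^bsup>-1/2\<^esup>\<close> and
  \<open>T = Stil\<^bsup>-1\<^esup> / beta\<close>, so its spectrum is real. Moreover \<open>Sbar = R R\<^sup>T + T\<close>, and from
  \<open>I / beta \<le> Stil \<le> Shat\<close> one gets \<open>T \<le> I \<le> Sbar \<le> \<beta>NE I\<close>. For an eigenvector \<open>(u, v)\<close> of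
  eigenvalue \<open>l\<close>, pairing the two block rows with \<open>u\<close> and \<open>v\<close> and eliminating the cross term
  \<open>u \<bullet> R\<^sup>T v\<close> (by evaluating suitable nonnegative quadratic forms) gives
  \<open>l\<^sup>2 - l + 1 \<le> \<beta>NE\<close> if \<open>l > 1\<close>, \<open>(1 + \<beta>H) l \<ge> 1\<close> if \<open>0 < l < 1\<close>, and
  \<open>- l \<ge> \<alpha>H\<close>, \<open>l\<^sup>2 \<le> - l \<beta>H + \<beta>NE\<close> if \<open>l < 0\<close>.\<close>

section \<open>The real spectral theorem\<close>

lemma scalar_prod_self_ge_0: "0 \<le> (v :: real vec) \<bullet> v"
  by (simp add: scalar_prod_def sum_nonneg)

lemma scalar_prod_self_eq_0_iff:
  assumes "(v :: real vec) \<in> carrier_vec n"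
  shows "v \<bullet> v = 0 \<longleftrightarrow> v = 0\<^sub>v n"
  using conjugate_square_eq_0_vec[OF assms] by simp

lemma scalar_prod_self_pos:
  assumes "(v :: real vec) \<in> carrier_vec n" "v \<noteq> 0\<^sub>v n"
  shows "0 < v \<bullet> v"
  using scalar_prod_self_eq_0_iff[OF assms(1)] scalar_prod_self_ge_0[of v] assms(2) by linarith

lemma scalar_prod_mult_mat_vec:
  assumes "(A :: 'a :: comm_semiring_0 mat) \<in> carrier_mat nr nc" "x \<in> carrier_vec nc" "y \<in> carrier_vec nr"
  shows "y \<bullet> (A *\<^sub>v x) = (transpose_mat A *\<^sub>v y) \<bullet> x"
  using transpose_vec_mult_scalar[OF assms] by simp

text \<open>Since \<open>A\<close> is real, \<open>conjugate v\<close> is an eigenvector for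
  \<open>cnj c\<close>. Symmetry moves \<open>A\<close> across the pairing of \<open>v\<close> with
  \<open>conjugate v\<close>, so \<open>c\<close> and \<open>cnj c\<close> multiply the same nonzero
  number.\<close>

lemma symmetric_eigenvalue_real:
  assumes A: "A \<in> carrier_mat n n" and sym: "transpose_mat A = (A :: real mat)"
    and ev: "eigenvalue (map_mat complex_of_real A) c"
  shows "c = complex_of_real (Re c)"
proof -
  let ?A = "map_mat complex_of_real A"
  have A': "?A \<in> carrier_mat n n" using A by simp
  from ev A' obtain v where v: "v \<in> carrier_vec n" "v \<noteq> 0\<^sub>v n" "?A *\<^sub>v v = c \<cdot>\<^sub>v v"
    unfolding eigenvalue_def eigenvector_def by auto
  have cv: "conjugate v \<in> carrier_vec n" using v by simp
  have "conjugate (?A *\<^sub>v v) = ?A *\<^sub>v conjugate v"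
    using A v(1) by (intro eq_vecI) (auto simp: scalar_prod_def sum_conjugate conjugate_dist_mul)
  hence cA: "?A *\<^sub>v conjugate v = cnj c \<cdot>\<^sub>v conjugate v"
    unfolding v(3) by (simp add: conjugate_smult_vec)
  have "c * (v \<bullet> conjugate v) = (?A *\<^sub>v v) \<bullet> conjugate v"
    unfolding v(3) using v(1) by simp
  also have "\<dots> = (transpose_mat ?A *\<^sub>v v) \<bullet> conjugate v"
  proof -
    have "transpose_mat ?A = map_mat complex_of_real (transpose_mat A)" by (rule eq_matI) auto
    thus ?thesis using sym by simp
  qed
  also have "\<dots> = v \<bullet> (?A *\<^sub>v conjugate v)"
    using transpose_vec_mult_scalar[OF A' cv v(1)] by simp
  also have "\<dots> = cnj c * (v \<bullet> conjugate v)" unfolding cA using v(1) by simp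
  finally have "c = cnj c" using v by simp
  thus ?thesis by (simp add: complex_eq_iff)
qed

text \<open>Both sides say that \<open>l\<close> is a root of the characteristic polynomial, which
  has the same real coefficients over either field.\<close>

lemma eigenvalue_of_real_iff:
  assumes A: "(A :: real mat) \<in> carrier_mat n n"
  shows "eigenvalue (map_mat complex_of_real A) (complex_of_real l) \<longleftrightarrow> eigenvalue A l"
  using A by (subst (1 2) eigenvalue_root_char_poly[where n = n])
    (auto simp: of_real_hom.char_poly_hom[OF A] of_real_hom.poly_map_poly)

text \<open>The complex spectrum is nonempty in positive dimension; its members are real and so
  descend to the real matrix.\<close>

lemma symmetric_eigenvalue_exists:
  assumes A: "A \<in> carrier_mat n n" and sym: "transpose_mat A = (A :: real mat)" and n: "0 < n"
  shows "\<exists>l. eigenvalue A l"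
proof -
  have "map_mat complex_of_real A \<in> carrier_mat n n" using A by simp
  from spectrum_non_empty[OF this n] obtain c where "eigenvalue (map_mat complex_of_real A) c"
    unfolding spectrum_def by auto
  with symmetric_eigenvalue_real[OF A sym this] eigenvalue_of_real_iff[OF A] show ?thesis by metis
qed

text \<open>Gram-Schmidt keeps the head of its input, so it is started from a basis that begins with
  \<open>v\<close>. Normalising then leaves \<open>v\<close> unchanged, as it already has length
  1.\<close>

lemma orthogonal_mat_with_first_col:
  assumes v: "(v :: real vec) \<in> carrier_vec n" and v1: "v \<bullet> v = 1" and n: "0 < n"
  shows "\<exists>W\<in>carrier_mat n n. transpose_mat W * W = 1\<^sub>m n \<and> col W 0 = v"
proof -
  interpret cof_vec_space n "TYPE(real)" .
  have v0: "v \<noteq> 0\<^sub>v n" using v1 by auto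
  define b where "b = basis_completion v"
  from basis_completion[OF v v0, folded b_def]
  have dist_b: "distinct b" and indep: "\<not> lin_dep (set b)" and b: "set b \<subseteq> carrier_vec n"
    and hdb: "hd b = v" and len_b: "length b = n" by auto
  from hdb len_b n obtain vs where bv: "b = v # vs" by (cases b) auto
  define ws where "ws = gram_schmidt n b"
  from gram_schmidt_result[OF b dist_b indep refl, folded ws_def]
  have ws: "set ws \<subseteq> carrier_vec n" "corthogonal ws" "length ws = n" by (auto simp: len_b)
  have hdws: "hd ws = v" using gram_schmidt_hd[OF v, of vs, folded bv] unfolding ws_def .
  have ws0: "ws ! 0 = v" using hdws ws(3) n by (metis hd_conv_nth length_greater_0_conv)
  define us where "us = map (\<lambda>w. (1 / sqrt (w \<bullet> w)) \<cdot>\<^sub>v w) ws"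
  define W where "W = mat_of_cols n us"
  have len: "length us = n" using ws unfolding us_def by simp
  have W: "W \<in> carrier_mat n n" unfolding W_def using len by auto
  have wsc: "ws ! i \<in> carrier_vec n" if "i < n" for i using ws that by (metis nth_mem subsetD)
  have col: "col W i = (1 / sqrt (ws ! i \<bullet> ws ! i)) \<cdot>\<^sub>v ws ! i" if "i < n" for i
    unfolding W_def using that ws len wsc[OF that] by (subst col_mat_of_cols) (auto simp: us_def)
  have "transpose_mat W * W = 1\<^sub>m n"
  proof (rule eq_matI)
    fix i j assume "i < dim_row (1\<^sub>m n :: real mat)" "j < dim_col (1\<^sub>m n :: real mat)"
    hence ij: "i < n" "j < n" by auto
    \<comment> \<open>The equivalence also carries nonvanishing: at \<open>i = j\<close> it says
      that the vector has a nonzero square, so dividing by its length is sound.\<close>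
    have o: "ws ! i \<bullet> ws ! j = 0 \<longleftrightarrow> i \<noteq> j" using corthogonalD[OF ws(2), of i j] ij ws(3) by simp
    have "(transpose_mat W * W) $$ (i,j) = col W i \<bullet> col W j" using W ij by simp
    also have "\<dots> = 1 / sqrt (ws ! i \<bullet> ws ! i) * (1 / sqrt (ws ! j \<bullet> ws ! j)) * (ws ! i \<bullet> ws ! j)"
      using wsc[OF ij(1)] wsc[OF ij(2)] unfolding col[OF ij(1)] col[OF ij(2)] by simp
    also have "\<dots> = (if i = j then 1 else 0)"
    proof (cases "i = j")
      case True
      have "0 < ws ! i \<bullet> ws ! i" using o True scalar_prod_self_ge_0[of "ws ! i"] by auto
      thus ?thesis using True by (simp add: real_sqrt_mult_self)
    qed (use o in simp)
    finally show "(transpose_mat W * W) $$ (i,j) = 1\<^sub>m n $$ (i,j)" using ij by simp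
  qed (use W in auto)
  moreover have "col W 0 = v" using col[OF n] v1 unfolding ws0 by simp
  ultimately show ?thesis using W by blast
qed

lemma mult_block_diag_mat:
  assumes "(A :: 'a :: comm_ring_1 mat) \<in> carrier_mat n n" "D \<in> carrier_mat m m"
    "A' \<in> carrier_mat n n" "D' \<in> carrier_mat m m"
  shows "four_block_mat A (0\<^sub>m n m) (0\<^sub>m m n) D * four_block_mat A' (0\<^sub>m n m) (0\<^sub>m m n) D' =
    four_block_mat (A * A') (0\<^sub>m n m) (0\<^sub>m m n) (D * D')"
  using assms by (subst mult_four_block_mat[of _ n n _ m _ m _ _ n _ m]) auto

text \<open>Deflation: a unit eigenvector is made the first basis vector, which splits off a 1 by 1
  block, and the induction hypothesis diagonalises the rest.\<close>

lemma symmetric_spectral_theorem: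
  assumes "A \<in> carrier_mat n n" and "transpose_mat A = (A :: real mat)"
  shows "\<exists>U d. U \<in> carrier_mat n n \<and> transpose_mat U * U = 1\<^sub>m n \<and>
    A = U * mat_diag n d * transpose_mat U"
  using assms
proof (induction n arbitrary: A)
  case 0
  show ?case
    by (rule exI[of _ "1\<^sub>m 0"]) (use 0 in \<open>auto intro!: eq_matI\<close>)
next
  case (Suc m)
  let ?n = "Suc m"
  note A = Suc.prems(1) and sym = Suc.prems(2)
  from symmetric_eigenvalue_exists[OF A sym] obtain e where "eigenvalue A e" by auto
  then obtain u where u: "u \<in> carrier_vec ?n" "u \<noteq> 0\<^sub>v ?n" "A *\<^sub>v u = e \<cdot>\<^sub>v u"
    using A unfolding eigenvalue_def eigenvector_def by auto
  define v where "v = (1 / sqrt (u \<bullet> u)) \<cdot>\<^sub>v u"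
  have uu: "0 < u \<bullet> u" using scalar_prod_self_pos[OF u(1,2)] .
  have v: "v \<in> carrier_vec ?n" using u v_def by simp
  have v1: "v \<bullet> v = 1" using u(1) uu unfolding v_def by simp
  have Av: "A *\<^sub>v v = e \<cdot>\<^sub>v v"
    unfolding v_def mult_mat_vec[OF A u(1)] u(3) by (simp add: smult_smult_assoc mult.commute)
  from orthogonal_mat_with_first_col[OF v v1] obtain W where
    W: "W \<in> carrier_mat ?n ?n" and WW: "transpose_mat W * W = 1\<^sub>m ?n" and W0: "col W 0 = v" by auto
  have Wt: "transpose_mat W \<in> carrier_mat ?n ?n" using W by simp
  have WW': "W * transpose_mat W = 1\<^sub>m ?n" using mat_mult_left_right_inverse[OF Wt W WW] .
  \<comment> \<open>In the basis of the columns of \<open>W\<close> the first column becomes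
    \<open>e\<close> times the first unit vector. Symmetry clears the first row as well, so
    \<open>B\<close> splits into \<open>e\<close> and a symmetric block \<open>B3\<close>.\<close>
  define B where "B = transpose_mat W * A * W"
  have B: "B \<in> carrier_mat ?n ?n" unfolding B_def using W A by simp
  have Bsym: "transpose_mat B = B"
    unfolding B_def using W A Wt sym
    by (simp add: transpose_mult[of _ ?n ?n _ ?n] assoc_mult_mat[of _ ?n ?n _ ?n _ ?n])
  have B0: "B $$ (i,0) = (if i = 0 then e else 0)" if i: "i < ?n" for i
  proof -
    have "B $$ (i,0) = (transpose_mat W * (A * W)) $$ (i,0)"
      unfolding B_def using W A Wt by (simp add: assoc_mult_mat[of _ ?n ?n _ ?n _ ?n])
    also have "\<dots> = row (transpose_mat W) i \<bullet> col (A * W) 0"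
      by (rule index_mult_mat(1)) (use W A i in auto)
    also have "\<dots> = col W i \<bullet> (A *\<^sub>v col W 0)"
      using W i unfolding col_mult2[OF A W zero_less_Suc] by (subst row_transpose) auto
    also have "\<dots> = e * (transpose_mat W * W) $$ (i,0)" using W i v unfolding W0 Av by (simp add: W0)
    finally show ?thesis unfolding WW using i by simp
  qed
  define B3 where "B3 = mat m m (\<lambda>(i,j). B $$ (Suc i, Suc j))"
  have B3: "B3 \<in> carrier_mat m m" unfolding B3_def by simp
  have sB: "B $$ (i,j) = B $$ (j,i)" if "i < ?n" "j < ?n" for i j
    using Bsym B that by (metis carrier_matD index_transpose_mat(1))
  have "transpose_mat B3 = B3" unfolding B3_def by (rule eq_matI) (auto simp: sB)
  from Suc.IH[OF B3 this] obtain U d where U: "U \<in> carrier_mat m m"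
    and UU: "transpose_mat U * U = 1\<^sub>m m" and B3U: "B3 = U * mat_diag m d * transpose_mat U" by blast
  let ?E = "mat 1 1 (\<lambda>_. e)"
  \<comment> \<open>\<open>case_nat\<close> prepends \<open>e\<close> to the eigenvalues of
    \<open>B3\<close>. Correspondingly \<open>F\<close> extends \<open>U\<close> by the identity on
    the first coordinate, and \<open>W * F\<close> is the orthogonal matrix sought.\<close>
  let ?d = "case_nat e d"
  define F where "F = four_block_mat (1\<^sub>m 1) (0\<^sub>m 1 m) (0\<^sub>m m 1) U"
  have F: "F \<in> carrier_mat ?n ?n" unfolding F_def using U by auto
  have Ft: "transpose_mat F \<in> carrier_mat ?n ?n" using F by simp
  have tF: "transpose_mat F = four_block_mat (1\<^sub>m 1) (0\<^sub>m 1 m) (0\<^sub>m m 1) (transpose_mat U)"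
    unfolding F_def using U by (subst transpose_four_block_mat[of _ 1 1 _ m _ m]) auto
  have FF: "transpose_mat F * F = 1\<^sub>m ?n"
    unfolding tF unfolding F_def
    using U by (simp add: mult_block_diag_mat[of _ "Suc 0" _ m] UU)
  have D: "mat_diag ?n ?d = four_block_mat ?E (0\<^sub>m 1 m) (0\<^sub>m m 1) (mat_diag m d)"
    by (rule eq_matI) (auto simp: mat_diag_def split: nat.splits)
  have Dc: "mat_diag ?n ?d \<in> carrier_mat ?n ?n" by simp
  have Bb: "B = four_block_mat ?E (0\<^sub>m 1 m) (0\<^sub>m m 1) B3"
    by (rule eq_matI) (use B B0 sB[of 0] in \<open>auto simp: B3_def\<close>)
  have dm: "mat_diag m d \<in> carrier_mat m m" by simp
  have FD: "F * mat_diag ?n ?d * transpose_mat F = B"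
    unfolding tF unfolding F_def D Bb B3U
    using U dm by (simp add: mult_block_diag_mat[of _ "Suc 0" _ m])
  have WBW: "W * B * transpose_mat W = A"
  proof -
    have "W * B * transpose_mat W = (W * transpose_mat W) * A * (W * transpose_mat W)"
      unfolding B_def using W Wt A by (simp add: assoc_mult_mat[of _ ?n ?n _ ?n _ ?n])
    thus ?thesis unfolding WW' using A by simp
  qed
  have WF: "W * F \<in> carrier_mat ?n ?n" using W F by simp
  have t: "transpose_mat (W * F) = transpose_mat F * transpose_mat W" using transpose_mult[OF W F] .
  have "transpose_mat (W * F) * (W * F) = transpose_mat F * (transpose_mat W * W) * F"
    unfolding t using W F Wt Ft by (simp add: assoc_mult_mat[of _ ?n ?n _ ?n _ ?n])
  hence 1: "transpose_mat (W * F) * (W * F) = 1\<^sub>m ?n" unfolding WW using Ft FF by simp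
  have "W * F * mat_diag ?n ?d * transpose_mat (W * F) = W * (F * mat_diag ?n ?d * transpose_mat F) * transpose_mat W"
    unfolding t using W F Wt Ft Dc by (simp add: assoc_mult_mat[of _ ?n ?n _ ?n _ ?n] mult_carrier_mat[of _ ?n ?n _ ?n])
  hence "A = W * F * mat_diag ?n ?d * transpose_mat (W * F)" unfolding FD WBW by simp
  with WF 1 show ?case by blast
qed

section \<open>Eigenvalues of a symmetric saddle point matrix\<close>

text \<open>The first row says \<open>w = (H + l) u\<close> for
  \<open>w = transpose_mat R *\<^sub>v v\<close>. The form of \<open>H + l\<close> lies between
  \<open>l\<close> and \<open>l + b\<close>, which traps the squared length \<open>r\<close> of
  \<open>w\<close>: \<open>l * q \<le> r \<le> (l + b) * q\<close> with
  \<open>q = u \<bullet> w\<close>. The left inequality yields the upper end of the interval, the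
  right one the lower end.\<close>

lemma saddle_point_positive_eigenvalue:
  assumes H: "H \<in> carrier_mat n n" and Hsym: "transpose_mat H = (H :: real mat)"
    and R: "R \<in> carrier_mat m n" and T: "T \<in> carrier_mat m m"
    and Hle: "\<And>u. u \<in> carrier_vec n \<Longrightarrow> u \<bullet> (H *\<^sub>v u) \<le> b * (u \<bullet> u)"
    and Hge: "\<And>u. u \<in> carrier_vec n \<Longrightarrow> 0 \<le> u \<bullet> (H *\<^sub>v u)" and b: "0 \<le> b"
    and Tge: "\<And>v. v \<in> carrier_vec m \<Longrightarrow> 0 \<le> v \<bullet> (T *\<^sub>v v)"
    and Tle: "\<And>v. v \<in> carrier_vec m \<Longrightarrow> v \<bullet> (T *\<^sub>v v) \<le> v \<bullet> v"
    and Sge: "\<And>v. v \<in> carrier_vec m \<Longrightarrow>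
      v \<bullet> v \<le> (transpose_mat R *\<^sub>v v) \<bullet> (transpose_mat R *\<^sub>v v) + v \<bullet> (T *\<^sub>v v)"
    and Sle: "\<And>v. v \<in> carrier_vec m \<Longrightarrow>
      (transpose_mat R *\<^sub>v v) \<bullet> (transpose_mat R *\<^sub>v v) + v \<bullet> (T *\<^sub>v v) \<le> c * (v \<bullet> v)"
    and u: "u \<in> carrier_vec n" and v: "v \<in> carrier_vec m"
    and nz: "u \<noteq> 0\<^sub>v n \<or> v \<noteq> 0\<^sub>v m" and l: "0 < l"
    and e1: "transpose_mat R *\<^sub>v v = H *\<^sub>v u + l \<cdot>\<^sub>v u"
    and e2: "R *\<^sub>v u + T *\<^sub>v v = l \<cdot>\<^sub>v v"
  shows "l \<in> {1 / (1 + b) .. 1 + sqrt (c - 1)}"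
proof -
  define w where "w = transpose_mat R *\<^sub>v v"
  have w: "w \<in> carrier_vec n" unfolding w_def using R v by auto
  have Hu: "H *\<^sub>v u \<in> carrier_vec n" and Tv: "T *\<^sub>v v \<in> carrier_vec m" and Ru: "R *\<^sub>v u \<in> carrier_vec m"
    and Hw: "H *\<^sub>v w \<in> carrier_vec n"
    using H T R u v w by auto
  define h where "h = u \<bullet> (H *\<^sub>v u)"
  define t where "t = v \<bullet> (T *\<^sub>v v)"
  define r where "r = w \<bullet> w"
  define q where "q = u \<bullet> w"
  have q1: "q = h + l * (u \<bullet> u)"
    using u Hu unfolding q_def h_def w_def e1 by (simp add: scalar_prod_add_distrib[of _ n])
  have "v \<bullet> (R *\<^sub>v u) = q"
    using u v w unfolding q_def scalar_prod_mult_mat_vec[OF R u v] w_def[symmetric]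
    by (rule_tac comm_scalar_prod)
  hence q2: "q + t = l * (v \<bullet> v)"
    using v Ru Tv arg_cong[OF e2, of "\<lambda>x. v \<bullet> x"] unfolding t_def
    by (simp add: scalar_prod_add_distrib[of _ m])
  have h: "0 \<le> h" using Hge[OF u] h_def by simp
  \<comment> \<open>If \<open>v\<close> were zero, the second row would force \<open>q = 0\<close>;
    as \<open>h\<close> is nonnegative, \<open>q1\<close> would then force \<open>u\<close> to
    vanish too.\<close>
  have v0: "v \<noteq> 0\<^sub>v m"
  proof
    assume *: "v = 0\<^sub>v m"
    hence "q + t = 0" "t = 0" using q2 v T unfolding t_def by auto
    hence "l * (u \<bullet> u) \<le> 0" using q1 h by simp
    hence "u \<bullet> u = 0" using l scalar_prod_self_ge_0[of u] by (simp add: mult_le_0_iff)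
    thus False using scalar_prod_self_eq_0_iff[OF u] nz * by simp
  qed
  hence vv: "0 < v \<bullet> v" using scalar_prod_self_pos[OF v] by simp
  have t0: "0 \<le> t" and t1: "t \<le> v \<bullet> v" and s1: "v \<bullet> v \<le> r + t" and s2: "r + t \<le> c * (v \<bullet> v)"
    using Tge[OF v] Tle[OF v] Sge[OF v] Sle[OF v] unfolding t_def r_def w_def by auto
  \<comment> \<open>Makes \<open>sqrt (c - 1)\<close> nonnegative, so that the upper bound holds at
    once for \<open>l \<le> 1\<close>.\<close>
  have c1: "1 \<le> c" 
  proof -
    have "1 * (v \<bullet> v) \<le> c * (v \<bullet> v)" using s1 s2 by simp
    thus ?thesis using vv by (simp only: mult_le_cancel_right_pos)
  qed
  have uu: "0 \<le> u \<bullet> u" using scalar_prod_self_ge_0 .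
  have wu: "w \<bullet> u = q" unfolding q_def using comm_scalar_prod[OF w u] .
  \<comment> \<open>Expand the square of \<open>w - l u\<close>. By \<open>q1\<close> and
    \<open>0 \<le> h\<close> its last term is at most \<open>l * q\<close>.\<close>
  have upper: "l * q \<le> r"
  proof -
    have "0 \<le> (w - l \<cdot>\<^sub>v u) \<bullet> (w - l \<cdot>\<^sub>v u)" by (rule scalar_prod_self_ge_0)
    also have "\<dots> = r - 2 * l * q + l * (l * (u \<bullet> u))"
      using w u wu by (simp add: minus_scalar_prod_distrib[of _ n] scalar_prod_minus_distrib[of _ n]
        r_def q_def algebra_simps)
    also have "\<dots> \<le> r - 2 * l * q + l * q" using q1 h l by simp
    finally show ?thesis by simp
  qed
  txt \<open>With \<open>K = H + l\<close> and \<open>w = K u\<close>, evaluate \<open>K\<close> at \<open>u - w / (l + b)\<close>.\<close>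
  have lower: "r \<le> (l + b) * q"
  proof -
    define s where "s = 1 / (l + b)"
    define x where "x = u - s \<cdot>\<^sub>v w"
    have lb: "0 < l + b" using l b by simp
    have sb: "s * (l + b) = 1" using lb unfolding s_def by simp
    have x: "x \<in> carrier_vec n" unfolding x_def using u w by simp
    have hw: "w \<bullet> (H *\<^sub>v w) \<le> b * r" using Hle[OF w] r_def by simp
    have uHw: "u \<bullet> (H *\<^sub>v w) = r - l * q"
    proof -
      have "u \<bullet> (H *\<^sub>v w) = (H *\<^sub>v u) \<bullet> w" using scalar_prod_mult_mat_vec[OF H w u] Hsym by simp
      also have "H *\<^sub>v u = w - l \<cdot>\<^sub>v u" unfolding w_def e1 using u H by (intro eq_vecI) auto
      finally show ?thesis using u w by (simp add: minus_scalar_prod_distrib[of _ n] r_def q_def)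
    qed
    have wHu: "w \<bullet> (H *\<^sub>v u) = r - l * q"
      using uHw scalar_prod_mult_mat_vec[OF H u w] Hsym comm_scalar_prod[OF u Hw] by simp
    have "0 \<le> x \<bullet> (H *\<^sub>v x) + l * (x \<bullet> x)" using Hge[OF x] l scalar_prod_self_ge_0[of x] by simp
    also have "x \<bullet> (H *\<^sub>v x) =
        h - s * (u \<bullet> (H *\<^sub>v w)) - s * (w \<bullet> (H *\<^sub>v u)) + s * (s * (w \<bullet> (H *\<^sub>v w)))"
      using u w Hu Hw H unfolding x_def h_def
      by (simp add: mult_minus_distrib_mat_vec[of _ n n] mult_mat_vec[of _ n n]
        minus_scalar_prod_distrib[of _ n] scalar_prod_minus_distrib[of _ n] algebra_simps)
    also have "x \<bullet> x = u \<bullet> u - 2 * s * q + s * (s * r)"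
      using u w wu unfolding x_def
      by (simp add: minus_scalar_prod_distrib[of _ n] scalar_prod_minus_distrib[of _ n]
        r_def q_def algebra_simps)
    also have "s * (s * (w \<bullet> (H *\<^sub>v w))) \<le> s * (s * (b * r))"
      using hw lb by (intro mult_left_mono) (auto simp: s_def)
    \<comment> \<open>The terms in \<open>l * q\<close> cancel, and \<open>s * (l + b) = 1\<close>
      reduces the last coefficient to \<open>s\<close>, which leaves
      \<open>q - s * r\<close>.\<close>
    finally have "0 \<le> q - 2 * s * r + s * (s * (l + b)) * r" using q1 unfolding uHw wHu by (simp add: algebra_simps)
    hence "s * r \<le> q" unfolding sb by (simp add: mult.commute)
    hence "(l + b) * (s * r) \<le> (l + b) * q" using lb by (intro mult_left_mono) auto
    moreover have "(l + b) * (s * r) = r" using sb by (metis mult.assoc mult.commute mult_1)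
    ultimately show ?thesis by simp
  qed
  \<comment> \<open>Only \<open>l < 1\<close> needs work: there \<open>l + b\<close> may be enlarged
    to \<open>1 + b\<close>, which bounds \<open>r + t\<close> by \<open>(1 + b) * (q + t)\<close>,
    and the second row evaluates \<open>q + t\<close>.\<close>
  have "1 / (1 + b) \<le> l"
  proof (cases "1 \<le> l")
    case True
    moreover have "1 / (1 + b) \<le> 1" using b by simp
    ultimately show ?thesis by linarith
  next
    case False
    have q0: "0 \<le> q" using q1 h l uu by simp
    have "(l + b) * q \<le> (1 + b) * q" using False q0 by (intro mult_right_mono) auto
    with lower have "r \<le> (1 + b) * q" by simp
    moreover have "t \<le> (1 + b) * t" using t0 b by (simp add: distrib_right)
    ultimately have "v \<bullet> v \<le> (1 + b) * (q + t)" using s1 by (simp add: distrib_left)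
    hence "1 * (v \<bullet> v) \<le> ((1 + b) * l) * (v \<bullet> v)" unfolding q2 by simp
    hence "1 \<le> (1 + b) * l" using vv by (simp only: mult_le_cancel_right_pos)
    thus ?thesis using b by (simp add: field_simps)
  qed
  moreover have "l \<le> 1 + sqrt (c - 1)"
  proof (cases "l \<le> 1")
    case True
    moreover have "0 \<le> sqrt (c - 1)" using c1 by simp
    ultimately show ?thesis by linarith
  next
    case False
    have "l * l * (v \<bullet> v) = l * q + l * t" using q2 by (metis distrib_left mult.assoc)
    \<comment> \<open>One copy of \<open>t\<close> joins \<open>r\<close>, to be bounded through
      \<open>c\<close>; the excess \<open>(l - 1) * t\<close> is bounded by
      \<open>t \<le> v \<bullet> v\<close>.\<close>
    also have "\<dots> \<le> r + t + (l - 1) * t" using upper by (simp add: algebra_simps)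
    also have "\<dots> \<le> c * (v \<bullet> v) + (l - 1) * (v \<bullet> v)"
      using s2 t1 False by (intro add_mono mult_left_mono) auto
    also have "\<dots> = (c + (l - 1)) * (v \<bullet> v)" by (simp add: algebra_simps)
    finally have "l * l \<le> c + (l - 1)" using vv by (simp only: mult_le_cancel_right_pos)
    \<comment> \<open>The preceding bound says that the square of \<open>l - 1\<close> is at most
      \<open>c - l\<close>, and \<open>l > 1\<close> weakens this to \<open>c - 1\<close>.\<close>
    hence "(l - 1)\<^sup>2 \<le> c - 1" using False by (simp add: power2_eq_square algebra_simps)
    hence "l - 1 \<le> sqrt (c - 1)" by (rule real_le_rsqrt)
    thus ?thesis by simp
  qed
  ultimately show ?thesis by simp
qed

text \<open>With \<open>k = - l\<close> the rows become \<open>h + q = k * (u \<bullet> u)\<close>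
  and \<open>q = t + k * (v \<bullet> v)\<close>. Dropping the nonnegative \<open>q\<close> from the
  first gives \<open>a \<le> k\<close>. Bounding \<open>k * q\<close> by
  \<open>w \<bullet> w\<close> and that by \<open>c * (u \<bullet> u)\<close> gives the quadratic
  inequality \<open>k * k \<le> k * b + c\<close>.\<close>

lemma saddle_point_negative_eigenvalue:
  assumes H: "H \<in> carrier_mat n n"
    and R: "R \<in> carrier_mat m n" and T: "T \<in> carrier_mat m m"
    and Hle: "\<And>u. u \<in> carrier_vec n \<Longrightarrow> u \<bullet> (H *\<^sub>v u) \<le> b * (u \<bullet> u)"
    and Hge: "\<And>u. u \<in> carrier_vec n \<Longrightarrow> a * (u \<bullet> u) \<le> u \<bullet> (H *\<^sub>v u)" and b: "0 \<le> b"
    and Tge: "\<And>v. v \<in> carrier_vec m \<Longrightarrow> 0 \<le> v \<bullet> (T *\<^sub>v v)"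
    and Sle: "\<And>v. v \<in> carrier_vec m \<Longrightarrow>
      (transpose_mat R *\<^sub>v v) \<bullet> (transpose_mat R *\<^sub>v v) + v \<bullet> (T *\<^sub>v v) \<le> c * (v \<bullet> v)"
    and c: "0 \<le> c"
    and u: "u \<in> carrier_vec n" and v: "v \<in> carrier_vec m"
    and nz: "u \<noteq> 0\<^sub>v n \<or> v \<noteq> 0\<^sub>v m" and l: "l < (0 :: real)"
    and e1: "transpose_mat R *\<^sub>v v = H *\<^sub>v u + l \<cdot>\<^sub>v u"
    and e2: "R *\<^sub>v u + T *\<^sub>v v = l \<cdot>\<^sub>v v"
  shows "l \<in> {- b - sqrt c .. - a}"
proof -
  define k where "k = - l"
  define w where "w = R *\<^sub>v u"
  define z where "z = transpose_mat R *\<^sub>v w"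
  have k: "0 < k" using l k_def by simp
  have w: "w \<in> carrier_vec m" unfolding w_def using R u by auto
  have z: "z \<in> carrier_vec n" unfolding z_def using R w by auto
  have Hu: "H *\<^sub>v u \<in> carrier_vec n" and Tv: "T *\<^sub>v v \<in> carrier_vec m"
    and Rv: "transpose_mat R *\<^sub>v v \<in> carrier_vec n"
    using H T R u v by auto
  define h where "h = u \<bullet> (H *\<^sub>v u)"
  define t where "t = v \<bullet> (T *\<^sub>v v)"
  define q where "q = - (v \<bullet> w)"
  have "v \<bullet> w = u \<bullet> (transpose_mat R *\<^sub>v v)"
    unfolding w_def scalar_prod_mult_mat_vec[OF R u v] using comm_scalar_prod[OF Rv u] .
  hence q1: "h + q = k * (u \<bullet> u)"
    using u Hu unfolding q_def h_def k_def e1 by (simp add: scalar_prod_add_distrib[of _ n])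
  have q2: "q = t + k * (v \<bullet> v)"
    using v w Tv arg_cong[OF e2, of "\<lambda>x. v \<bullet> x"] unfolding t_def q_def k_def w_def[symmetric]
    by (simp add: scalar_prod_add_distrib[of _ m])
  have t: "0 \<le> t" using Tge[OF v] t_def by simp
  have vv: "0 \<le> v \<bullet> v" using scalar_prod_self_ge_0 .
  have u0: "u \<noteq> 0\<^sub>v n"
  proof
    assume *: "u = 0\<^sub>v n"
    hence "h = 0" "u \<bullet> u = 0" using u H unfolding h_def by auto
    hence "k * (v \<bullet> v) \<le> 0" using q1 q2 t by simp
    hence "v \<bullet> v = 0" using k vv by (simp add: mult_le_0_iff)
    thus False using scalar_prod_self_eq_0_iff[OF v] nz * by simp
  qed
  hence uu: "0 < u \<bullet> u" using scalar_prod_self_pos[OF u] by simp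
  have "a * (u \<bullet> u) \<le> k * (u \<bullet> u)" 
  proof -
    have "0 \<le> k * (v \<bullet> v)" using k vv by simp
    thus ?thesis using Hge[OF u] q1 q2 t unfolding h_def by linarith
  qed
  hence ak: "a \<le> k" using uu by (simp only: mult_le_cancel_right_pos)
  have wv: "w \<bullet> v = - q" unfolding q_def using comm_scalar_prod[OF w v] by simp
  \<comment> \<open>In this square the last term is at most \<open>k * q\<close> by
    \<open>q2\<close>, which leaves \<open>k * q \<le> w \<bullet> w\<close>.\<close>
  have "0 \<le> (w + k \<cdot>\<^sub>v v) \<bullet> (w + k \<cdot>\<^sub>v v)" by (rule scalar_prod_self_ge_0)
  also have "\<dots> = w \<bullet> w - 2 * k * q + k * (k * (v \<bullet> v))"
    using w v wv by (simp add: add_scalar_prod_distrib[of _ m] scalar_prod_add_distrib[of _ m]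
        q_def algebra_simps)
  also have "\<dots> \<le> w \<bullet> w - 2 * k * q + k * q" using q2 t k by simp
  finally have kq: "k * q \<le> w \<bullet> w" by simp
  have zc: "z \<bullet> z \<le> c * (w \<bullet> w)" using Sle[OF w] Tge[OF w] unfolding z_def by simp
  have uz: "u \<bullet> z = w \<bullet> w"
    using scalar_prod_mult_mat_vec[OF R u w] comm_scalar_prod[OF u z] unfolding z_def w_def[symmetric] by simp
  \<comment> \<open>\<open>Sle\<close> bounds \<open>R * R^T\<close>, whereas the bound is wanted
    for \<open>R^T * R\<close>. It is transferred by expanding the square of \<open>z - c u\<close>;
    a factor \<open>c\<close> gets cancelled, hence the separate case \<open>c = 0\<close>.\<close>
  have wc: "w \<bullet> w \<le> c * (u \<bullet> u)"
  proof (cases "c = 0")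
    case True
    hence "z \<bullet> z = 0" using zc scalar_prod_self_ge_0[of z] by simp
    hence "z = 0\<^sub>v n" using scalar_prod_self_eq_0_iff[OF z] by simp
    thus ?thesis using uz u True by simp
  next
    case False
    have "0 \<le> (z - c \<cdot>\<^sub>v u) \<bullet> (z - c \<cdot>\<^sub>v u)" by (rule scalar_prod_self_ge_0)
    also have "\<dots> = z \<bullet> z - 2 * c * (w \<bullet> w) + c * (c * (u \<bullet> u))"
      using z u uz comm_scalar_prod[OF u z]
      by (simp add: minus_scalar_prod_distrib[of _ n] scalar_prod_minus_distrib[of _ n] algebra_simps)
    finally have "c * (w \<bullet> w) \<le> c * (c * (u \<bullet> u))" using zc by simp
    thus ?thesis using False c by simp
  qed
  have "k * k * (u \<bullet> u) = k * h + k * q" using q1 by (metis distrib_left mult.assoc)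
  also have "\<dots> \<le> k * (b * (u \<bullet> u)) + c * (u \<bullet> u)"
    using Hle[OF u] kq wc k unfolding h_def by (intro add_mono mult_left_mono) auto
  also have "\<dots> = (k * b + c) * (u \<bullet> u)" by (simp add: algebra_simps)
  finally have kk: "k * k \<le> k * b + c" using uu by (simp only: mult_le_cancel_right_pos)
  \<comment> \<open>Beyond this bound both \<open>k\<close> and \<open>k - b\<close> exceed
    \<open>sqrt c\<close>, so their product would exceed \<open>c\<close>, against
    \<open>kk\<close>.\<close>
  have "k \<le> b + sqrt c"
  proof (rule ccontr)
    assume "\<not> k \<le> b + sqrt c"
    hence 1: "sqrt c < k - b" by simp
    have "sqrt c * sqrt c \<le> sqrt c * (k - b)" using 1 c by (intro mult_left_mono) auto
    also have "\<dots> < k * (k - b)" using 1 b c real_sqrt_ge_zero[OF c] by (intro mult_strict_right_mono) linarith+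
    finally show False using kk c by (simp add: algebra_simps)
  qed
  with ak show ?thesis unfolding k_def by simp
qed

text \<open>The sign of \<open>l\<close> selects one of the two estimates. At \<open>l = 0\<close>
  the rows add up to \<open>u \<bullet> (H *\<^sub>v u) + v \<bullet> (T *\<^sub>v v) = 0\<close>,
  which definiteness of \<open>H\<close> and \<open>T\<close> forbids.\<close>

lemma saddle_point_eigenvalue:
  assumes H: "H \<in> carrier_mat n n" and Hsym: "transpose_mat H = (H :: real mat)"
    and R: "R \<in> carrier_mat m n" and T: "T \<in> carrier_mat m m"
    and Hle: "\<And>u. u \<in> carrier_vec n \<Longrightarrow> u \<bullet> (H *\<^sub>v u) \<le> b * (u \<bullet> u)"
    and Hge: "\<And>u. u \<in> carrier_vec n \<Longrightarrow> a * (u \<bullet> u) \<le> u \<bullet> (H *\<^sub>v u)" and b: "0 \<le> b"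
    and Hpos: "\<And>u. u \<in> carrier_vec n \<Longrightarrow> u \<noteq> 0\<^sub>v n \<Longrightarrow> 0 < u \<bullet> (H *\<^sub>v u)"
    and Tpos: "\<And>v. v \<in> carrier_vec m \<Longrightarrow> v \<noteq> 0\<^sub>v m \<Longrightarrow> 0 < v \<bullet> (T *\<^sub>v v)"
    and Tle: "\<And>v. v \<in> carrier_vec m \<Longrightarrow> v \<bullet> (T *\<^sub>v v) \<le> v \<bullet> v"
    and Sge: "\<And>v. v \<in> carrier_vec m \<Longrightarrow>
      v \<bullet> v \<le> (transpose_mat R *\<^sub>v v) \<bullet> (transpose_mat R *\<^sub>v v) + v \<bullet> (T *\<^sub>v v)"
    and Sle: "\<And>v. v \<in> carrier_vec m \<Longrightarrow>
      (transpose_mat R *\<^sub>v v) \<bullet> (transpose_mat R *\<^sub>v v) + v \<bullet> (T *\<^sub>v v) \<le> c * (v \<bullet> v)"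
    and c: "0 \<le> c"
    and ev: "eigenvalue (four_block_mat (- H) (transpose_mat R) R T) l"
  shows "l \<in> {- b - sqrt c .. - a} \<union> {1 / (1 + b) .. 1 + sqrt (c - 1)}"
proof -
  have Hge0: "0 \<le> u \<bullet> (H *\<^sub>v u)" if "u \<in> carrier_vec n" for u
    using Hpos[OF that] H that by (cases "u = 0\<^sub>v n") (auto intro: less_imp_le)
  have Tge0: "0 \<le> v \<bullet> (T *\<^sub>v v)" if "v \<in> carrier_vec m" for v
    using Tpos[OF that] T that by (cases "v = 0\<^sub>v m") (auto intro: less_imp_le)
  have nH: "- H \<in> carrier_mat n n" and Rt: "transpose_mat R \<in> carrier_mat n m" using H R by auto
  from ev obtain x where x: "x \<in> carrier_vec (n + m)" "x \<noteq> 0\<^sub>v (n + m)"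
    "four_block_mat (- H) (transpose_mat R) R T *\<^sub>v x = l \<cdot>\<^sub>v x"
    using H T unfolding eigenvalue_def eigenvector_def by auto
  define u where "u = vec_first x n"
  define v where "v = vec_last x m"
  have u: "u \<in> carrier_vec n" and v: "v \<in> carrier_vec m" and xuv: "x = u @\<^sub>v v"
    using x unfolding u_def v_def by auto
  have nz: "u \<noteq> 0\<^sub>v n \<or> v \<noteq> 0\<^sub>v m" using x(2) unfolding xuv by auto
  have lx: "l \<cdot>\<^sub>v (u @\<^sub>v v) = l \<cdot>\<^sub>v u @\<^sub>v l \<cdot>\<^sub>v v" by (rule eq_vecI) auto
  have "(- H *\<^sub>v u + transpose_mat R *\<^sub>v v) @\<^sub>v (R *\<^sub>v u + T *\<^sub>v v) = l \<cdot>\<^sub>v u @\<^sub>v l \<cdot>\<^sub>v v"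
    using x(3) unfolding xuv four_block_mat_mult_vec[OF nH Rt R T u v] lx .
  hence e: "- H *\<^sub>v u + transpose_mat R *\<^sub>v v = l \<cdot>\<^sub>v u" and e2: "R *\<^sub>v u + T *\<^sub>v v = l \<cdot>\<^sub>v v"
    using H R u v by (subst (asm) append_vec_eq[of _ n], auto)+
  have Hu: "H *\<^sub>v u \<in> carrier_vec n" and Rv: "transpose_mat R *\<^sub>v v \<in> carrier_vec n"
    and Ru: "R *\<^sub>v u \<in> carrier_vec m" and Tv: "T *\<^sub>v v \<in> carrier_vec m" using H R T u v by auto
  have "H *\<^sub>v u + l \<cdot>\<^sub>v u = H *\<^sub>v u + (- (H *\<^sub>v u) + transpose_mat R *\<^sub>v v)"
    using e H u by simp
  also have "\<dots> = transpose_mat R *\<^sub>v v" using H R u v by (intro eq_vecI) auto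
  finally have e1: "transpose_mat R *\<^sub>v v = H *\<^sub>v u + l \<cdot>\<^sub>v u" by simp
  consider "0 < l" | "l < 0" | "l = 0" by linarith
  thus ?thesis
  proof cases
    case 1
    from saddle_point_positive_eigenvalue[OF H Hsym R T Hle Hge0 b Tge0 Tle Sge Sle u v nz 1 e1 e2]
    show ?thesis by simp
  next
    case 2
    from saddle_point_negative_eigenvalue[OF H R T Hle Hge b Tge0 Sle c u v nz 2 e1 e2]
    show ?thesis by simp
  next
    case 3
    have "u \<bullet> (H *\<^sub>v u) = u \<bullet> (transpose_mat R *\<^sub>v v)" unfolding e1 3 using u H
      by (intro arg_cong[of _ _ "\<lambda>x. u \<bullet> x"] eq_vecI) auto
    also have "\<dots> = v \<bullet> (R *\<^sub>v u)"
      using scalar_prod_mult_mat_vec[OF R u v] comm_scalar_prod[OF u Rv] by simp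
    also have "v \<bullet> (R *\<^sub>v u) + v \<bullet> (T *\<^sub>v v) = 0"
      using arg_cong[OF e2, of "\<lambda>x. v \<bullet> x"] 3 v Ru Tv by (simp add: scalar_prod_add_distrib[of _ m])
    hence "v \<bullet> (R *\<^sub>v u) = - (v \<bullet> (T *\<^sub>v v))" by simp
    finally have "u \<bullet> (H *\<^sub>v u) + v \<bullet> (T *\<^sub>v v) = 0" by simp
    with Hpos[OF u] Tpos[OF v] Hge0[OF u] Tge0[OF v] nz have False by fastforce
    thus ?thesis ..
  qed
qed

section \<open>Rayleigh quotients, square roots and positive definite matrices\<close>

text \<open>Orthogonality turns the factorisation into \<open>A * U = U * mat_diag n d\<close>,
  whose columns are eigenvector equations; the diagonal of \<open>transpose_mat U * U\<close> gives
  the lengths.\<close>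

lemma orthogonal_diagonalisation_eigen:
  assumes U: "U \<in> carrier_mat n n" and UU: "transpose_mat U * U = 1\<^sub>m n"
    and A: "A = U * mat_diag n d * transpose_mat (U :: real mat)" and i: "i < n"
  shows "A *\<^sub>v col U i = d i \<cdot>\<^sub>v col U i" "col U i \<bullet> col U i = 1" "eigenvalue A (d i)"
proof -
  have Ut: "transpose_mat U \<in> carrier_mat n n" and D: "mat_diag n d \<in> carrier_mat n n" using U by auto
  have A': "A \<in> carrier_mat n n" unfolding A using U Ut D by (simp add: mult_carrier_mat[of _ n n _ n])
  have "A * U = U * mat_diag n d * (transpose_mat U * U)"
    unfolding A using U Ut D by (simp add: assoc_mult_mat[of _ n n _ n _ n] mult_carrier_mat[of _ n n _ n])
  also have "\<dots> = U * mat_diag n d" unfolding UU using U D by (simp add: mult_carrier_mat[of _ n n _ n] right_mult_one_mat[of _ n n])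
  finally have AU: "A * U = U * mat_diag n d" .
  have "A *\<^sub>v col U i = col (A * U) i" using col_mult2[OF A' U i] by simp
  also have "\<dots> = d i \<cdot>\<^sub>v col U i" unfolding AU mat_diag_mult_right[OF U]
    using U i by (intro eq_vecI) (auto simp: mult.commute)
  finally show e: "A *\<^sub>v col U i = d i \<cdot>\<^sub>v col U i" .
  have "(transpose_mat U * U) $$ (i,i) = col U i \<bullet> col U i" using U i by simp
  thus o: "col U i \<bullet> col U i = 1" unfolding UU using i by simp
  have "col U i \<noteq> 0\<^sub>v n" using o by auto
  thus "eigenvalue A (d i)" using e A' U unfolding eigenvalue_def eigenvector_def
    by (intro exI[of _ "col U i"]) auto
qed

lemma scalar_prod_mat_diag:
  assumes "(x :: real vec) \<in> carrier_vec n"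
  shows "x \<bullet> (mat_diag n f *\<^sub>v x) = (\<Sum>i<n. f i * (x $ i)\<^sup>2)"
proof -
  have "(mat_diag n f *\<^sub>v x) $ i = f i * x $ i" if "i < n" for i
  proof -
    have "(mat_diag n f *\<^sub>v x) $ i = (\<Sum>j\<in>{0..<n}. (if i = j then f j * x $ j else 0))"
    proof -
      have "(mat_diag n f *\<^sub>v x) $ i = (\<Sum>j\<in>{0..<n}. (if i = j then f j else 0) * x $ j)"
        using assms that by (auto simp: scalar_prod_def mat_diag_def intro!: sum.cong)
      also have "\<dots> = (\<Sum>j\<in>{0..<n}. (if i = j then f j * x $ j else 0))" by (intro sum.cong) auto
      finally show ?thesis .
    qed
    thus ?thesis using that by simp
  qed
  hence "x \<bullet> (mat_diag n f *\<^sub>v x) = x \<bullet> vec n (\<lambda>i. f i * x $ i)"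
    using assms by (intro arg_cong[of _ _ "\<lambda>z. x \<bullet> z"] eq_vecI) (auto simp: mat_diag_def)
  thus ?thesis using assms
    by (auto simp: scalar_prod_def power2_eq_square lessThan_atLeast0 intro!: sum.cong)
qed

text \<open>In the coordinates \<open>y\<close> of \<open>v\<close> along an orthonormal eigenbasis,
  both forms are sums of squares with weights 1 and \<open>d i\<close>, so it suffices to bound each
  \<open>d i\<close>.\<close>

lemma rayleigh_bounds:
  assumes A: "A \<in> carrier_mat n n" and sym: "transpose_mat A = A" and v: "v \<in> carrier_vec n"
  shows "lam_min A * (v \<bullet> v) \<le> v \<bullet> (A *\<^sub>v v)" "v \<bullet> (A *\<^sub>v v) \<le> lam_max A * (v \<bullet> v)"
proof -
  from symmetric_spectral_theorem[OF A sym] obtain U d where U: "U \<in> carrier_mat n n"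
    and UU: "transpose_mat U * U = 1\<^sub>m n" and AU: "A = U * mat_diag n d * transpose_mat U" by blast
  have Ut: "transpose_mat U \<in> carrier_mat n n" and D: "mat_diag n d \<in> carrier_mat n n" using U by auto
  define y where "y = transpose_mat U *\<^sub>v v"
  have y: "y \<in> carrier_vec n" using U v y_def by auto
  have "U * transpose_mat U = 1\<^sub>m n" using mat_mult_left_right_inverse[OF Ut U UU] .
  hence "v = U *\<^sub>v y" unfolding y_def using U Ut v by (metis assoc_mult_mat_vec one_mult_mat_vec)
  hence "v \<bullet> v = v \<bullet> (U *\<^sub>v y)" by simp
  also have "\<dots> = y \<bullet> y" using scalar_prod_mult_mat_vec[OF U y v] y_def by simp
  finally have vv: "v \<bullet> v = (\<Sum>i<n. (y $ i)\<^sup>2)"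
    using y by (simp add: scalar_prod_def power2_eq_square lessThan_atLeast0)
  have "A *\<^sub>v v = U *\<^sub>v (mat_diag n d *\<^sub>v y)"
    unfolding AU y_def using U Ut D v by (simp add: assoc_mult_mat_vec[of _ n n _ n] mult_carrier_mat[of _ n n _ n])
  hence "v \<bullet> (A *\<^sub>v v) = y \<bullet> (mat_diag n d *\<^sub>v y)"
    using scalar_prod_mult_mat_vec[OF U mult_mat_vec_carrier[OF D y] v] y_def by simp
  hence vAv: "v \<bullet> (A *\<^sub>v v) = (\<Sum>i<n. d i * (y $ i)\<^sup>2)" using scalar_prod_mat_diag[OF y] by simp
  have mem: "d i \<in> spectrum A" if "i < n" for i
    using orthogonal_diagonalisation_eigen(3)[OF U UU AU that] unfolding spectrum_def by simp
  have fin: "finite (spectrum A)" using card_finite_spectrum(1)[OF A] .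
  \<comment> \<open>The index \<open>i < n\<close> excludes size 0, so the default value of
    \<open>lam_min\<close> and \<open>lam_max\<close> does not arise here; in size 0 the sums below
    are empty.\<close>
  have "lam_min A \<le> d i" "d i \<le> lam_max A" if "i < n" for i
    using A that mem[OF that] fin unfolding lam_min_def lam_max_def by auto
  thus "lam_min A * (v \<bullet> v) \<le> v \<bullet> (A *\<^sub>v v)" "v \<bullet> (A *\<^sub>v v) \<le> lam_max A * (v \<bullet> v)"
    unfolding vv vAv sum_distrib_left by (auto intro!: sum_mono mult_right_mono)
qed

text \<open>Take square roots of the eigenvalues in a diagonalisation; each \<open>d i\<close> is
  nonnegative, being the form of \<open>M\<close> at the unit vector \<open>col U i\<close>.\<close>

lemma sym_psd_sqrt_exists:
  assumes M: "sym_psd n M"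
  shows "\<exists>R. sym_psd n R \<and> R * R = M"
proof -
  have Mc: "M \<in> carrier_mat n n" and sym: "transpose_mat M = M"
    and pos: "\<And>v. v \<in> carrier_vec n \<Longrightarrow> 0 \<le> v \<bullet> (M *\<^sub>v v)" using M unfolding sym_psd_def by auto
  from symmetric_spectral_theorem[OF Mc sym] obtain U d where U: "U \<in> carrier_mat n n"
    and UU: "transpose_mat U * U = 1\<^sub>m n" and MU: "M = U * mat_diag n d * transpose_mat U" by blast
  have Ut: "transpose_mat U \<in> carrier_mat n n" using U by auto
  have d: "0 \<le> d i" if "i < n" for i
    using pos[of "col U i"] orthogonal_diagonalisation_eigen(1,2)[OF U UU MU that] U by auto
  define D where "D = mat_diag n (\<lambda>i. sqrt (d i))"
  have D: "D \<in> carrier_mat n n" unfolding D_def by simp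
  have Dt: "transpose_mat D = D" unfolding D_def mat_diag_def by (rule eq_matI) auto
  have DD: "D * D = mat_diag n d" unfolding D_def mat_diag_diag
    unfolding mat_diag_def using d by (intro cong_mat) auto
  define R where "R = U * D * transpose_mat U"
  have R: "R \<in> carrier_mat n n" unfolding R_def using U D by simp
  have Rt: "transpose_mat R = R"
    unfolding R_def using U Ut D Dt by (simp add: transpose_mult[of _ n n _ n]
      assoc_mult_mat[of _ n n _ n _ n] mult_carrier_mat[of _ n n _ n])
  have "R * R = U * D * (transpose_mat U * U) * D * transpose_mat U"
    unfolding R_def using U Ut D by (simp add: assoc_mult_mat[of _ n n _ n _ n] mult_carrier_mat[of _ n n _ n])
  also have "\<dots> = U * (D * D) * transpose_mat U"
    unfolding UU using U Ut D by (simp add: assoc_mult_mat[of _ n n _ n _ n] mult_carrier_mat[of _ n n _ n])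
  finally have RR: "R * R = M" unfolding DD MU .
  have "0 \<le> v \<bullet> (R *\<^sub>v v)" if v: "v \<in> carrier_vec n" for v
  proof -
    let ?y = "transpose_mat U *\<^sub>v v"
    have y: "?y \<in> carrier_vec n" using U v by auto
    have Dy: "D *\<^sub>v ?y \<in> carrier_vec n" using D y by auto
    have "R *\<^sub>v v = U *\<^sub>v (D *\<^sub>v ?y)"
      unfolding R_def using U Ut D v by (simp add: assoc_mult_mat_vec[of _ n n _ n] mult_carrier_mat[of _ n n _ n])
    hence "v \<bullet> (R *\<^sub>v v) = ?y \<bullet> (D *\<^sub>v ?y)" using scalar_prod_mult_mat_vec[OF U Dy v] by simp
    also have "\<dots> = (\<Sum>i<n. sqrt (d i) * (?y $ i)\<^sup>2)" unfolding D_def by (rule scalar_prod_mat_diag[OF y])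
    also have "0 \<le> \<dots>" using d by (intro sum_nonneg) auto
    finally show ?thesis .
  qed
  with R Rt RR show ?thesis unfolding sym_psd_def by blast
qed

section \<open>Inverses and inverse square roots of definite matrices\<close>

lemma minv_eqI:
  assumes A: "A \<in> carrier_mat n n" and B: "B \<in> carrier_mat n n" and AB: "A * B = 1\<^sub>m n"
  shows "minv A = B"
\<comment> \<open>\<open>None\<close> would mean that \<open>A\<close> is not a unit, but a
  one-sided inverse of a square matrix is two-sided. In the other case the left inverse
  \<open>C\<close> and the right inverse \<open>B\<close> coincide.\<close>
proof (cases "mat_inverse A")
  case None
  have "A \<in> Units (ring_mat TYPE(real) n ())"
    using A B AB mat_mult_left_right_inverse[OF A B AB] unfolding Units_def ring_mat_def by auto
  with mat_inverse(1)[OF A None, of "()"] show ?thesis by blast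
next
  case (Some C)
  from mat_inverse(2)[OF A Some] have C: "C \<in> carrier_mat n n" and CA: "C * A = 1\<^sub>m n" by auto
  have "C = C * (A * B)" unfolding AB using C by simp
  also have "\<dots> = (C * A) * B" using A B C by simp
  also have "\<dots> = B" unfolding CA using B by simp
  finally show ?thesis unfolding minv_def Some by simp
qed

definition sym_pd :: "nat \<Rightarrow> real mat \<Rightarrow> bool" where
  "sym_pd n M \<longleftrightarrow> M \<in> carrier_mat n n \<and> transpose_mat M = M \<and>
     (\<forall>v\<in>carrier_vec n. v \<noteq> 0\<^sub>v n \<longrightarrow> 0 < v \<bullet> (M *\<^sub>v v))"

lemma sym_pd_imp_sym_psd:
  assumes "sym_pd n M"
  shows "sym_psd n M"
  unfolding sym_psd_def
proof (intro conjI ballI)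
  fix v :: "real vec" assume v: "v \<in> carrier_vec n"
  show "0 \<le> v \<bullet> (M *\<^sub>v v)"
  proof (cases "v = 0\<^sub>v n")
    case True
    thus ?thesis using assms unfolding sym_pd_def by (auto intro: order_eq_refl)
  next
    case False
    thus ?thesis using assms v unfolding sym_pd_def by (auto intro: less_imp_le)
  qed
qed (use assms in \<open>auto simp: sym_pd_def\<close>)

lemma sym_pd_minv:
  assumes M: "sym_pd n M"
  shows "minv M \<in> carrier_mat n n" "M * minv M = 1\<^sub>m n" "minv M * M = 1\<^sub>m n"
proof -
  have Mc: "M \<in> carrier_mat n n" using M unfolding sym_pd_def by simp
  have "det M \<noteq> 0"
  proof
    assume "det M = 0"
    then obtain v where v: "v \<in> carrier_vec n" "v \<noteq> 0\<^sub>v n" "M *\<^sub>v v = 0\<^sub>v n"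
      using det_0_iff_vec_prod_zero[OF Mc] by auto
    thus False using M unfolding sym_pd_def by fastforce
  qed
  hence "M \<in> Units (ring_mat TYPE(real) n ())" using det_non_zero_imp_unit[OF Mc, where b = "()"] by simp
  with mat_inverse(1)[OF Mc, of "()"] obtain B where B: "mat_inverse M = Some B" by fastforce
  from mat_inverse(2)[OF Mc B]
  show "minv M \<in> carrier_mat n n" "M * minv M = 1\<^sub>m n" "minv M * M = 1\<^sub>m n"
    unfolding minv_def B by auto
qed

text \<open>About the chosen root \<open>Q\<close> only symmetry and \<open>Q * Q = M\<close> are
  used. Its inverse is \<open>Q * minv M\<close>, and all claims follow by cancelling
  \<open>Q\<close> against \<open>K\<close>.\<close>

lemma sym_pd_minv_sqrt:
  assumes M: "sym_pd n M"
  defines "K \<equiv> minv_sqrt M"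
  shows "K \<in> carrier_mat n n" "transpose_mat K = K" "K * K = minv M" "K * M * K = 1\<^sub>m n"
    "\<exists>Q\<in>carrier_mat n n. K * Q = 1\<^sub>m n \<and> Q * K = 1\<^sub>m n"
proof -
  have Mc: "M \<in> carrier_mat n n" using M unfolding sym_pd_def by simp
  define Q where "Q = mat_sqrt M"
  have "sym_psd (dim_row M) Q \<and> Q * Q = M"
    unfolding Q_def mat_sqrt_def using Mc sym_psd_sqrt_exists[OF sym_pd_imp_sym_psd[OF M]]
    by (intro someI_ex[of "\<lambda>R. sym_psd (dim_row M) R \<and> R * R = M"]) auto
  hence Q: "Q \<in> carrier_mat n n" and Qt: "transpose_mat Q = Q" and QQ: "Q * Q = M"
    using Mc unfolding sym_psd_def by auto
  note inv = sym_pd_minv[OF M]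
  note assoc = assoc_mult_mat[of _ n n _ n _ n] mult_carrier_mat[of _ n n _ n]
  have QI: "Q * minv M \<in> carrier_mat n n" using Q inv(1) by simp
  have "Q * (Q * minv M) = 1\<^sub>m n" using Q inv QQ by (simp flip: assoc_mult_mat[of _ n n _ n _ n])
  hence "K = Q * minv M" unfolding K_def minv_sqrt_def Q_def[symmetric] using minv_eqI[OF Q QI] by simp
  hence Kc: "K \<in> carrier_mat n n" and QK: "Q * K = 1\<^sub>m n"
    using QI \<open>Q * (Q * minv M) = 1\<^sub>m n\<close> by auto
  have KQ: "K * Q = 1\<^sub>m n" using mat_mult_left_right_inverse[OF Q Kc QK] .
  show "K \<in> carrier_mat n n" by fact
  have Ktc: "transpose_mat K \<in> carrier_mat n n" using Kc by simp
  have "Q * transpose_mat K = 1\<^sub>m n"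
    using arg_cong[OF KQ, of transpose_mat] transpose_mult[OF Kc Q] Qt by simp
  hence "minv Q = transpose_mat K" by (rule minv_eqI[OF Q Ktc])
  thus "transpose_mat K = K" unfolding K_def minv_sqrt_def Q_def[symmetric] by simp
  have "M * (K * K) = Q * (Q * K) * K" unfolding QQ[symmetric] using Q Kc by (simp add: assoc)
  also have "\<dots> = 1\<^sub>m n" using Q Kc QK by simp
  finally show "K * K = minv M" using minv_eqI[OF Mc, of "K * K"] Kc by simp
  have "K * M * K = (K * Q) * (Q * K)" unfolding QQ[symmetric] using Q Kc by (simp add: assoc)
  thus "K * M * K = 1\<^sub>m n" unfolding KQ QK by simp
  show "\<exists>Q\<in>carrier_mat n n. K * Q = 1\<^sub>m n \<and> Q * K = 1\<^sub>m n" using Q KQ QK by blast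
qed

section \<open>Principal submatrices and diagonal matrices\<close>

lemma bij_betw_pick:
  assumes "finite J"
  shows "bij_betw (pick J) {..<card J} J"
proof -
  have inj: "inj_on (pick J) {..<card J}"
    by (rule linorder_inj_onI) (use pick_mono_le in fastforce)+
  have "pick J ` {..<card J} \<subseteq> J" using pick_in_set_le by auto
  moreover have "card (pick J ` {..<card J}) = card J" using card_image[OF inj] by simp
  ultimately have "pick J ` {..<card J} = J" using assms by (intro card_subset_eq)
  with inj show ?thesis unfolding bij_betw_def by simp
qed

lemma scalar_prod_mat_vec_eq_sum:
  assumes "(M :: real mat) \<in> carrier_mat n n" "v \<in> carrier_vec n"
  shows "v \<bullet> (M *\<^sub>v v) = (\<Sum>i<n. \<Sum>j<n. v $ i * (M $$ (i,j) * v $ j))"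
  using assms by (auto simp: scalar_prod_def sum_distrib_left lessThan_atLeast0 intro!: sum.cong)

lemma sym_pd_principal_submatrix:
  assumes M: "sym_pd n M" and J: "J \<subseteq> {..<n}"
  shows "sym_pd (card J) (submatrix M J J)"
proof -
  have Mc: "M \<in> carrier_mat n n" and Mt: "transpose_mat M = M" using M unfolding sym_pd_def by auto
  have fJ: "finite J" using J finite_subset by blast
  have "{i. i < n \<and> i \<in> J} = J" using J by auto
  hence sub: "submatrix M J J = mat (card J) (card J) (\<lambda>(p,q). M $$ (pick J p, pick J q))"
    unfolding submatrix_def using Mc by simp
  have pk: "pick J p < n" "pick J p \<in> J" if "p < card J" for p using pick_in_set_le[OF that] J by auto
  have sc: "submatrix M J J \<in> carrier_mat (card J) (card J)" unfolding sub by simp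
  have "M $$ (i,j) = M $$ (j,i)" if "i < n" "j < n" for i j
    using Mt Mc that by (metis carrier_matD index_transpose_mat(1))
  hence st: "transpose_mat (submatrix M J J) = submatrix M J J"
    unfolding sub using pk by (intro eq_matI) auto
  have "0 < v \<bullet> (submatrix M J J *\<^sub>v v)" if v: "v \<in> carrier_vec (card J)" and v0: "v \<noteq> 0\<^sub>v (card J)" for v
  proof -
    \<comment> \<open>\<open>w\<close> extends \<open>v\<close> by zeros outside \<open>J\<close>.
      The number of smaller members of \<open>J\<close> is the position of \<open>i\<close> in
      \<open>J\<close>, which inverts \<open>pick J\<close>. The form of \<open>M\<close> at
      \<open>w\<close> then equals that of the submatrix at \<open>v\<close>.\<close>
    define w where "w = vec n (\<lambda>i. if i \<in> J then v $ card {a\<in>J. a < i} else 0)"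
    have w: "w \<in> carrier_vec n" unfolding w_def by simp
    have wp: "w $ pick J p = v $ p" if "p < card J" for p
      unfolding w_def using pk[OF that] card_pick[of p J] that by simp
    have w_out: "w $ i = 0" if "i < n" "i \<notin> J" for i unfolding w_def using that by simp
    from v v0 obtain p where p: "p < card J" "v $ p \<noteq> 0" by (metis carrier_vecD eq_vecI index_zero_vec)
    have "w \<noteq> 0\<^sub>v n" using wp[OF p(1)] p pk[OF p(1)] by auto
    hence "0 < w \<bullet> (M *\<^sub>v w)" using M w unfolding sym_pd_def by auto
    also have "\<dots> = (\<Sum>i<n. \<Sum>j<n. w $ i * (M $$ (i,j) * w $ j))" by (rule scalar_prod_mat_vec_eq_sum[OF Mc w])
    also have "\<dots> = (\<Sum>i\<in>J. \<Sum>j\<in>J. w $ i * (M $$ (i,j) * w $ j))"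
    proof -
      have "(\<Sum>j<n. w $ i * (M $$ (i,j) * w $ j)) = (\<Sum>j\<in>J. w $ i * (M $$ (i,j) * w $ j))" for i
        using J w_out by (intro sum.mono_neutral_right) auto
      moreover have "(\<Sum>i<n. \<Sum>j\<in>J. w $ i * (M $$ (i,j) * w $ j)) = (\<Sum>i\<in>J. \<Sum>j\<in>J. w $ i * (M $$ (i,j) * w $ j))"
        using J w_out by (intro sum.mono_neutral_right) auto
      ultimately show ?thesis by simp
    qed
    also have "\<dots> = (\<Sum>p<card J. \<Sum>q<card J. v $ p * (submatrix M J J $$ (p,q) * v $ q))"
      unfolding sum.reindex_bij_betw[OF bij_betw_pick[OF fJ], symmetric]
      by (intro sum.cong refl) (auto simp: wp sub)
    also have "\<dots> = v \<bullet> (submatrix M J J *\<^sub>v v)" by (rule scalar_prod_mat_vec_eq_sum[OF sc v, symmetric])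
    finally show ?thesis .
  qed
  with sc st show ?thesis unfolding sym_pd_def by blast
qed

lemma sym_pd_diag_pos:
  assumes M: "sym_pd n M" and i: "i < n"
  shows "0 < M $$ (i,i)"
proof -
  have Mc: "M \<in> carrier_mat n n" using M unfolding sym_pd_def by simp
  have "unit_vec n i \<noteq> (0\<^sub>v n :: real vec)" using i by (metis index_unit_vec(2) index_zero_vec(1) zero_neq_one)
  hence "0 < unit_vec n i \<bullet> (M *\<^sub>v unit_vec n i)" using M unfolding sym_pd_def by auto
  also have "M *\<^sub>v unit_vec n i = col M i" using Mc i by (intro eq_vecI) auto
  also have "unit_vec n i \<bullet> col M i = M $$ (i,i)" using Mc i by simp
  finally show ?thesis .
qed

lemma sym_pd_mat_diag:
  assumes "\<And>i. i < n \<Longrightarrow> 0 < f i"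
  shows "sym_pd n (mat_diag n f)"
proof -
  have "0 < v \<bullet> (mat_diag n f *\<^sub>v v)" if v: "v \<in> carrier_vec n" "v \<noteq> 0\<^sub>v n" for v
  proof -
    from v obtain i where i: "i < n" "v $ i \<noteq> 0" by (metis carrier_vecD eq_vecI index_zero_vec)
    show ?thesis unfolding scalar_prod_mat_diag[OF v(1)]
      by (rule sum_pos2[of _ i]) (use i assms in \<open>auto intro!: mult_nonneg_nonneg simp: less_imp_le\<close>)
  qed
  moreover have "transpose_mat (mat_diag n f) = mat_diag n f" unfolding mat_diag_def by (rule eq_matI) auto
  ultimately show ?thesis unfolding sym_pd_def by simp
qed

lemma minv_mat_diag:
  assumes "\<And>i. i < n \<Longrightarrow> f i \<noteq> 0"
  shows "minv (mat_diag n f) = mat_diag n (\<lambda>i. inverse (f i))"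
proof (rule minv_eqI)
  show "mat_diag n f * mat_diag n (\<lambda>i. inverse (f i)) = 1\<^sub>m n"
    unfolding mat_diag_diag unfolding mat_diag_def using assms by (intro eq_matI) auto
qed simp_all

section \<open>Regularised normal equations\<close>

lemma smult_one_mat_mult_vec:
  assumes "(v :: 'a :: comm_semiring_1 vec) \<in> carrier_vec n"
  shows "(k \<cdot>\<^sub>m 1\<^sub>m n) *\<^sub>v v = k \<cdot>\<^sub>v v"
  using assms by (intro eq_vecI) auto

lemma transpose_normal_equation:
  assumes A: "(A :: real mat) \<in> carrier_mat m n" and D: "D \<in> carrier_mat n n"
    and Dt: "transpose_mat D = D"
  shows "transpose_mat (A * D * transpose_mat A + \<kappa> \<cdot>\<^sub>m 1\<^sub>m m) =
    A * D * transpose_mat A + \<kappa> \<cdot>\<^sub>m 1\<^sub>m m"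
proof -
  have At: "transpose_mat A \<in> carrier_mat n m" using A by simp
  have AD: "A * D \<in> carrier_mat m n" and ADA: "A * D * transpose_mat A \<in> carrier_mat m m"
    using A At D by auto
  have I: "\<kappa> \<cdot>\<^sub>m 1\<^sub>m m \<in> carrier_mat m m" by simp
  have "transpose_mat (\<kappa> \<cdot>\<^sub>m 1\<^sub>m m :: real mat) = \<kappa> \<cdot>\<^sub>m 1\<^sub>m m" by (rule eq_matI) auto
  thus ?thesis using transpose_add[OF ADA I] transpose_mult[OF AD At] transpose_mult[OF A D]
    Dt assoc_mult_mat[OF A D At] by simp
qed

text \<open>\<open>Shat\<close> and \<open>Stil\<close> have this shape and differ only in
  \<open>D\<close>, so their comparison reduces to comparing two diagonal forms at the common vector
  \<open>transpose_mat A *\<^sub>v v\<close>.\<close>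

lemma scalar_prod_normal_equation:
  assumes A: "(A :: real mat) \<in> carrier_mat m n" and v: "v \<in> carrier_vec m" and D: "D \<in> carrier_mat n n"
  shows "v \<bullet> ((A * D * transpose_mat A + \<kappa> \<cdot>\<^sub>m 1\<^sub>m m) *\<^sub>v v) =
    (transpose_mat A *\<^sub>v v) \<bullet> (D *\<^sub>v (transpose_mat A *\<^sub>v v)) + \<kappa> * (v \<bullet> v)"
proof -
  let ?y = "transpose_mat A *\<^sub>v v"
  have At: "transpose_mat A \<in> carrier_mat n m" and y: "?y \<in> carrier_vec n" using A v by auto
  have Dy: "D *\<^sub>v ?y \<in> carrier_vec n" and AD: "A * D \<in> carrier_mat m n" and ADA: "A * D * transpose_mat A \<in> carrier_mat m m"
    using A D y by auto
  have "(A * D * transpose_mat A) *\<^sub>v v = A *\<^sub>v (D *\<^sub>v ?y)"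
    using A At D v y AD by (simp add: assoc_mult_mat_vec[of _ m n _ m] assoc_mult_mat_vec[of _ m n _ n])
  hence "(A * D * transpose_mat A + \<kappa> \<cdot>\<^sub>m 1\<^sub>m m) *\<^sub>v v = A *\<^sub>v (D *\<^sub>v ?y) + \<kappa> \<cdot>\<^sub>v v"
    using add_mult_distrib_mat_vec[OF ADA _ v] smult_one_mat_mult_vec[OF v] by simp
  thus ?thesis using A v Dy scalar_prod_mult_mat_vec[OF A Dy v]
    by (simp add: scalar_prod_add_distrib[of _ m])
qed

section \<open>The preconditioned matrix\<close>

text \<open>Symmetric scaling amounts to the substitution of \<open>K *\<^sub>v v\<close> for
  \<open>v\<close>; this reduces claims on \<open>Hb\<close>, \<open>Sb\<close> and \<open>T\<close>
  to the unscaled matrices.\<close>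

lemma scalar_prod_sandwich:
  assumes K: "(K :: real mat) \<in> carrier_mat n n" and Kt: "transpose_mat K = K"
    and M: "M \<in> carrier_mat n n" and v: "v \<in> carrier_vec n"
  shows "v \<bullet> ((K * M * K) *\<^sub>v v) = (K *\<^sub>v v) \<bullet> (M *\<^sub>v (K *\<^sub>v v))"
proof -
  have Kv: "M *\<^sub>v (K *\<^sub>v v) \<in> carrier_vec n" using M K v by auto
  have "(K * M * K) *\<^sub>v v = K *\<^sub>v (M *\<^sub>v (K *\<^sub>v v))"
    using K M v by (simp add: assoc_mult_mat_vec[of _ n n _ n] mult_carrier_mat[of _ n n _ n])
  thus ?thesis using scalar_prod_mult_mat_vec[OF K Kv v] Kt by simp
qed

text \<open>Separates the linear algebra from the algorithm: the Schur complement approximation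
  enters through the order relations \<open>St_ge\<close> and \<open>St_le\<close>. The
  preconditioned product need not be symmetric, hence the complex spectrum in the
  conclusion.\<close>

lemma preconditioned_saddle_point_spectrum:
  assumes H: "sym_pd n H" and Ht: "sym_pd n Ht" and A: "A \<in> carrier_mat m n" and \<kappa>: "0 < \<kappa>"
    and St: "sym_pd m St"
    and St_ge: "\<And>v. v \<in> carrier_vec m \<Longrightarrow> \<kappa> * (v \<bullet> v) \<le> v \<bullet> (St *\<^sub>v v)"
    and Sh: "Sh = A * minv Ht * transpose_mat A + \<kappa> \<cdot>\<^sub>m 1\<^sub>m m"
    and St_le: "\<And>v. v \<in> carrier_vec m \<Longrightarrow> v \<bullet> (St *\<^sub>v v) \<le> v \<bullet> (Sh *\<^sub>v v)"
    and Hb: "Hb = minv_sqrt Ht * H * minv_sqrt Ht"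
    and Sb: "Sb = minv_sqrt St * Sh * minv_sqrt St"
    and a: "a = lam_min Hb" and b: "b = lam_max Hb" and c: "c = lam_max Sb"
  shows "spectrum (map_mat complex_of_real
      (minv (four_block_mat Ht (0\<^sub>m n m) (0\<^sub>m m n) St)
        * four_block_mat (- H) (transpose_mat A) A (\<kappa> \<cdot>\<^sub>m 1\<^sub>m m)))
    \<subseteq> complex_of_real ` ({- b - sqrt c .. - a} \<union> {1 / (1 + b) .. 1 + sqrt (c - 1)})"
proof -
  define G where "G = minv_sqrt Ht"
  define K where "K = minv_sqrt St"
  note GG = sym_pd_minv_sqrt[OF Ht, folded G_def]
  note KK = sym_pd_minv_sqrt[OF St, folded K_def]
  from GG(5) obtain G' where G': "G' \<in> carrier_mat n n" "G * G' = 1\<^sub>m n" "G' * G = 1\<^sub>m n" by auto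
  from KK(5) obtain K' where K': "K' \<in> carrier_mat m m" "K * K' = 1\<^sub>m m" "K' * K = 1\<^sub>m m" by auto
  note G = GG(1) and Gt = GG(2) and K = KK(1) and Kt = KK(2)
  have Hc: "H \<in> carrier_mat n n" and Hs: "transpose_mat H = H" using H unfolding sym_pd_def by auto
  have Htc: "Ht \<in> carrier_mat n n" using Ht unfolding sym_pd_def by auto
  have Stc: "St \<in> carrier_mat m m" using St unfolding sym_pd_def by auto
  have At: "transpose_mat A \<in> carrier_mat n m" using A by simp
  have I: "\<kappa> \<cdot>\<^sub>m 1\<^sub>m m \<in> carrier_mat m m" by simp
  note HI = sym_pd_minv[OF Ht] and SI = sym_pd_minv[OF St]
  have Shc: "Sh \<in> carrier_mat m m" unfolding Sh using A At HI(1) by simp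
  \<comment> \<open>\<open>R\<close> and \<open>T\<close> are the lower blocks of the saddle point
    matrix after scaling on both sides by the block diagonal matrix of \<open>G\<close> and
    \<open>K\<close>.\<close>
  define R where "R = K * A * G"
  define T where "T = K * (\<kappa> \<cdot>\<^sub>m 1\<^sub>m m) * K"
  have R: "R \<in> carrier_mat m n" unfolding R_def using K A G by simp
  have Rt: "transpose_mat R = G * transpose_mat A * K"
    unfolding R_def using K A G Kt Gt At
    by (simp add: transpose_mult[of _ m n _ n] transpose_mult[of _ m m _ n] assoc_mult_mat[of _ n n _ m _ m])
  have T: "T \<in> carrier_mat m m" unfolding T_def using K I by (simp add: mult_carrier_mat[of _ m m _ m])
  have Hbc: "Hb \<in> carrier_mat n n" unfolding Hb G_def[symmetric] using G Hc by simp
  have Hbs: "transpose_mat Hb = Hb"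
    unfolding Hb G_def[symmetric] using G Hc Gt Hs
    by (simp add: transpose_mult[of _ n n _ n] assoc_mult_mat[of _ n n _ n _ n] mult_carrier_mat[of _ n n _ n])
  have Sbc: "Sb \<in> carrier_mat m m" unfolding Sb K_def[symmetric] using K Shc by simp
  have HIt: "transpose_mat (minv Ht) = minv Ht"
    unfolding GG(3)[symmetric] using G Gt by (simp add: transpose_mult[of _ n n _ n])
  have Shs: "transpose_mat Sh = Sh" unfolding Sh by (rule transpose_normal_equation[OF A HI(1) HIt])
  have Sbs: "transpose_mat Sb = Sb"
    unfolding Sb K_def[symmetric] using K Shc Kt Shs
    by (simp add: transpose_mult[of _ m m _ m] assoc_mult_mat[of _ m m _ m _ m] mult_carrier_mat[of _ m m _ m])
  have Kv: "K *\<^sub>v v \<in> carrier_vec m" if "v \<in> carrier_vec m" for v using K that by auto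
  have inj: "M *\<^sub>v v \<noteq> 0\<^sub>v k"
    if "M' * M = 1\<^sub>m k" "M' \<in> carrier_mat k k" "M \<in> carrier_mat k k" "v \<in> carrier_vec k" "v \<noteq> 0\<^sub>v k"
    for M M' :: "real mat" and k v
  proof
    assume z: "M *\<^sub>v v = 0\<^sub>v k"
    have "v = M' *\<^sub>v (M *\<^sub>v v)" using that by (metis assoc_mult_mat_vec one_mult_mat_vec)
    also have "\<dots> = 0\<^sub>v k" unfolding z using that(2) by auto
    finally show False using that(5) by simp
  qed
  \<comment> \<open>Because \<open>K * St * K\<close> is the identity, comparing \<open>St\<close>
    with other matrices at \<open>K *\<^sub>v v\<close> means comparing the scaled matrices with the
    identity at \<open>v\<close>.\<close>
  have vv: "v \<bullet> v = (K *\<^sub>v v) \<bullet> (St *\<^sub>v (K *\<^sub>v v))" if v: "v \<in> carrier_vec m" for v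
    using scalar_prod_sandwich[OF K Kt Stc v] v unfolding KK(4) by simp
  have Tq: "v \<bullet> (T *\<^sub>v v) = \<kappa> * ((K *\<^sub>v v) \<bullet> (K *\<^sub>v v))" if v: "v \<in> carrier_vec m" for v
  proof -
    show ?thesis unfolding T_def scalar_prod_sandwich[OF K Kt I v] smult_one_mat_mult_vec[OF Kv[OF v]]
      using Kv[OF v] by simp
  qed
  \<comment> \<open>As \<open>G * G = minv Ht\<close>, this is the form of \<open>Sb\<close>, split
    into its \<open>R\<close> part and its regularisation part \<open>T\<close>.\<close>
  have Sq: "(transpose_mat R *\<^sub>v v) \<bullet> (transpose_mat R *\<^sub>v v) + v \<bullet> (T *\<^sub>v v)
      = (K *\<^sub>v v) \<bullet> (Sh *\<^sub>v (K *\<^sub>v v))" if v: "v \<in> carrier_vec m" for v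
  proof -
    define y where "y = transpose_mat A *\<^sub>v (K *\<^sub>v v)"
    have y: "y \<in> carrier_vec n" unfolding y_def using At Kv[OF v] by auto
    have Gy: "G *\<^sub>v y \<in> carrier_vec n" using G y by auto
    have GA: "G * transpose_mat A \<in> carrier_mat n m" using G At by simp
    have Ry: "transpose_mat R *\<^sub>v v = G *\<^sub>v y"
      unfolding Rt y_def assoc_mult_mat_vec[OF GA K v] assoc_mult_mat_vec[OF G At Kv[OF v]] ..
    have "(G *\<^sub>v y) \<bullet> (G *\<^sub>v y) = y \<bullet> (G *\<^sub>v (G *\<^sub>v y))"
      using scalar_prod_mult_mat_vec[OF G Gy y] Gt by simp
    also have "\<dots> = y \<bullet> (minv Ht *\<^sub>v y)" unfolding GG(3)[symmetric] using G y by simp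
    finally show ?thesis unfolding Ry Tq[OF v] Sh scalar_prod_normal_equation[OF A Kv[OF v] HI(1)] y_def by simp
  qed
  have Sbq: "v \<bullet> (Sb *\<^sub>v v) = (K *\<^sub>v v) \<bullet> (Sh *\<^sub>v (K *\<^sub>v v))" if "v \<in> carrier_vec m" for v
    unfolding Sb K_def[symmetric] by (rule scalar_prod_sandwich[OF K Kt Shc that])
  have Hbq: "u \<bullet> (Hb *\<^sub>v u) = (G *\<^sub>v u) \<bullet> (H *\<^sub>v (G *\<^sub>v u))" if "u \<in> carrier_vec n" for u
    unfolding Hb G_def[symmetric] by (rule scalar_prod_sandwich[OF G Gt Hc that])
  have Hpos: "0 < u \<bullet> (Hb *\<^sub>v u)" if u: "u \<in> carrier_vec n" "u \<noteq> 0\<^sub>v n" for u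
    unfolding Hbq[OF u(1)] using H inj[OF G'(3,1) G u] G u unfolding sym_pd_def by auto
  have Tpos: "0 < v \<bullet> (T *\<^sub>v v)" if v: "v \<in> carrier_vec m" "v \<noteq> 0\<^sub>v m" for v
    unfolding Tq[OF v(1)] using \<kappa> scalar_prod_self_pos[OF Kv[OF v(1)] inj[OF K'(3,1) K v]] by simp
  have Tle: "v \<bullet> (T *\<^sub>v v) \<le> v \<bullet> v" if v: "v \<in> carrier_vec m" for v
    unfolding Tq[OF v] vv[OF v] by (rule St_ge[OF Kv[OF v]])
  have Sge: "v \<bullet> v \<le> (transpose_mat R *\<^sub>v v) \<bullet> (transpose_mat R *\<^sub>v v) + v \<bullet> (T *\<^sub>v v)"
    if v: "v \<in> carrier_vec m" for v
    unfolding Sq[OF v] vv[OF v] by (rule St_le[OF Kv[OF v]])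
  have Sle: "(transpose_mat R *\<^sub>v v) \<bullet> (transpose_mat R *\<^sub>v v) + v \<bullet> (T *\<^sub>v v) \<le> c * (v \<bullet> v)"
    if v: "v \<in> carrier_vec m" for v
    unfolding Sq[OF v] Sbq[OF v, symmetric] c by (rule rayleigh_bounds(2)[OF Sbc Sbs v])
  have unit: "unit_vec k 0 \<in> carrier_vec k" "unit_vec k 0 \<noteq> (0\<^sub>v k :: real vec)"
    "unit_vec k 0 \<bullet> unit_vec k 0 = (1 :: real)" if "k \<noteq> 0" for k
    using that by (auto simp: unit_vec_def dest: arg_cong[of _ _ "\<lambda>v. v $ 0"]) (simp add: unit_vec_def[symmetric])
  \<comment> \<open>In size 0 the convention gives \<open>b = 0\<close>; otherwise a unit vector and
    positivity of \<open>Hb\<close> give the sign.\<close>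
  have b0: "0 \<le> b"
  proof (cases "n = 0")
    case True
    thus ?thesis using Hbc unfolding b lam_max_def by simp
  next
    case False
    note e = unit[OF False]
    show ?thesis using rayleigh_bounds(2)[OF Hbc Hbs e(1)] Hpos[OF e(1,2)] e(3) unfolding b by simp
  qed
  have c0: "0 \<le> c"
  proof (cases "m = 0")
    case True
    thus ?thesis using Sbc unfolding c lam_max_def by simp
  next
    case False
    note e = unit[OF False]
    show ?thesis using Sge[OF e(1)] Sle[OF e(1)] e(3) by simp
  qed
  define W where "W = four_block_mat (- Hb) (transpose_mat R) R T"
  define P where "P = four_block_mat G (0\<^sub>m n m) (0\<^sub>m m n) K"
  define P' where "P' = four_block_mat G' (0\<^sub>m n m) (0\<^sub>m m n) K'"
  define Mt where "Mt = four_block_mat Ht (0\<^sub>m n m) (0\<^sub>m m n) St"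
  define Mh where "Mh = four_block_mat (- H) (transpose_mat A) A (\<kappa> \<cdot>\<^sub>m 1\<^sub>m m)"
  let ?N = "minv Mt * Mh"
  have P: "P \<in> carrier_mat (n+m) (n+m)" and P': "P' \<in> carrier_mat (n+m) (n+m)"
    and Mt: "Mt \<in> carrier_mat (n+m) (n+m)" and Mh: "Mh \<in> carrier_mat (n+m) (n+m)"
    and W: "W \<in> carrier_mat (n+m) (n+m)"
    unfolding P_def P'_def Mt_def Mh_def W_def using G K G' K' Htc Stc Hc Hbc T by auto
  have PP': "P * P' = 1\<^sub>m (n+m)" "P' * P = 1\<^sub>m (n+m)"
    unfolding P_def P'_def using G K G' K' by (simp_all add: mult_block_diag_mat[of _ n _ m])
  \<comment> \<open>So \<open>P\<close> is a square root of the inverse preconditioner, and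
    \<open>minv Mt * Mh\<close> is \<open>P * (P * Mh * P) * P'\<close> with \<open>P'\<close>
    inverse to \<open>P\<close>: the similarity to \<open>W\<close>.\<close>
  have PP: "P * P = minv Mt"
  proof (rule minv_eqI[symmetric, OF Mt])
    show "P * P \<in> carrier_mat (n+m) (n+m)" using P by simp
    show "Mt * (P * P) = 1\<^sub>m (n+m)"
      unfolding Mt_def P_def using G K Htc Stc HI SI GG(3) KK(3)
      by (simp add: mult_block_diag_mat[of _ n _ m] del: assoc_mult_mat)
  qed
  have PM: "P * Mh * P = W"
  proof -
    have "P * Mh = four_block_mat (- (G * H)) (G * transpose_mat A) (K * A) (K * (\<kappa> \<cdot>\<^sub>m 1\<^sub>m m))"
      unfolding P_def Mh_def using G K Hc A At
      by (subst mult_four_block_mat[of _ n n _ m _ m _ _ n _ m]) auto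
    thus ?thesis unfolding P_def W_def Rt unfolding Hb G_def[symmetric] R_def T_def using G K Hc A At
      by (subst (asm) eq_commute, simp, subst mult_four_block_mat[of _ n n _ m _ m _ _ n _ m]) auto
  qed
  have sim: "similar_mat ?N W"
  proof (rule similar_matI)
    have "?N = P * P * Mh * (P * P')" unfolding PP[symmetric] PP' using P Mh by simp
    also have "\<dots> = P * W * P'" unfolding PM[symmetric] using P P' Mh
      by (simp add: assoc_mult_mat[of _ "n+m" "n+m" _ "n+m" _ "n+m"] mult_carrier_mat[of _ "n+m" "n+m" _ "n+m"])
    finally show "?N = P * W * P'" .
    show "{?N, W, P, P'} \<subseteq> carrier_mat (n+m) (n+m)" unfolding PP[symmetric] using P P' W Mh by auto
  qed (use PP' in auto)
  have N: "?N \<in> carrier_mat (n+m) (n+m)" unfolding PP[symmetric] using P Mh by simp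
  have Ts: "transpose_mat T = T"
  proof -
    have "transpose_mat (\<kappa> \<cdot>\<^sub>m 1\<^sub>m m :: real mat) = \<kappa> \<cdot>\<^sub>m 1\<^sub>m m" by (rule eq_matI) auto
    thus ?thesis unfolding T_def using K Kt I transpose_mult[OF mult_carrier_mat[OF K I] K] transpose_mult[OF K I]
        assoc_mult_mat[OF K I K] by simp
  qed
  have nHb: "- Hb \<in> carrier_mat n n" and Rtc: "transpose_mat R \<in> carrier_mat n m" using Hbc R by auto
  have Ws: "transpose_mat W = W"
    unfolding W_def transpose_four_block_mat[OF nHb Rtc R T] using Hbs Ts by (simp add: transpose_uminus)
  show ?thesis
  proof
    fix z assume "z \<in> spectrum (map_mat complex_of_real
      (minv (four_block_mat Ht (0\<^sub>m n m) (0\<^sub>m m n) St)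
        * four_block_mat (- H) (transpose_mat A) A (\<kappa> \<cdot>\<^sub>m 1\<^sub>m m)))"
    hence z: "eigenvalue (map_mat complex_of_real ?N) z" unfolding spectrum_def Mt_def Mh_def by simp
    have cN: "map_mat complex_of_real ?N \<in> carrier_mat (n+m) (n+m)"
      and cW: "map_mat complex_of_real W \<in> carrier_mat (n+m) (n+m)" using N W by auto
    \<comment> \<open>Similarity holds over the reals; the common real characteristic polynomial
      carries the complex eigenvalues over.\<close>
    have zW: "eigenvalue (map_mat complex_of_real W) z"
      using z char_poly_similar[OF sim]
      unfolding eigenvalue_root_char_poly[OF cN] eigenvalue_root_char_poly[OF cW]
        of_real_hom.char_poly_hom[OF N] of_real_hom.char_poly_hom[OF W] by simp
    from symmetric_eigenvalue_real[OF W Ws zW] have zr: "z = complex_of_real (Re z)" .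
    have "eigenvalue W (Re z)" using zW zr eigenvalue_of_real_iff[OF W] by metis
    from saddle_point_eigenvalue[OF Hbc Hbs R T rayleigh_bounds(2)[OF Hbc Hbs, folded b]
        rayleigh_bounds(1)[OF Hbc Hbs, folded a] b0 Hpos Tpos Tle Sge Sle c0 this[unfolded W_def]]
    show "z \<in> complex_of_real ` ({- b - sqrt c .. - a} \<union> {1 / (1 + b) .. 1 + sqrt (c - 1)})"
      using zr by blast
  qed
qed

section \<open>The reduced matrices at an iterate\<close>

lemma sym_pd_add_mat_diag:
  assumes Q: "sym_psd n Q" and d: "\<And>i. i < n \<Longrightarrow> 0 < d i"
  shows "sym_pd n (Q + mat_diag n d)"
proof -
  have D: "sym_pd n (mat_diag n d)" using d by (rule sym_pd_mat_diag)
  have Qc: "Q \<in> carrier_mat n n" and Qt: "transpose_mat Q = Q" using Q unfolding sym_psd_def by auto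
  have Dc: "mat_diag n d \<in> carrier_mat n n" and Dt: "transpose_mat (mat_diag n d) = mat_diag n d"
    using D unfolding sym_pd_def by auto
  have "0 < v \<bullet> ((Q + mat_diag n d) *\<^sub>v v)" if v: "v \<in> carrier_vec n" "v \<noteq> 0\<^sub>v n" for v
  proof -
    note c = mult_mat_vec_carrier[OF Qc v(1)] mult_mat_vec_carrier[OF Dc v(1)]
    have "0 \<le> v \<bullet> (Q *\<^sub>v v)" "0 < v \<bullet> (mat_diag n d *\<^sub>v v)"
      using Q D v unfolding sym_psd_def sym_pd_def by auto
    thus ?thesis unfolding add_mult_distrib_mat_vec[OF Qc Dc v(1)] scalar_prod_add_distrib[OF v(1) c] by simp
  qed
  thus ?thesis using Qc Dc Qt Dt transpose_add[OF Qc Dc] unfolding sym_pd_def by simp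
qed

theorem theorem3p2:
  fixes P :: qp
    and \<tau> \<beta> \<epsilon> \<eta> :: "nat \<Rightarrow> real" and \<tau>inf :: real and \<beta>inf :: ereal
    and x y z xs ys :: "nat \<Rightarrow> real vec"
    and \<zeta> \<mu> \<delta> :: real
    and k j :: nat
    and S :: subproblem
    and \<alpha>H \<beta>H \<beta>NE :: real
  assumes problem: "qp_problem P"
    and inputs: "pmm_inputs \<tau> \<tau>inf \<beta> \<beta>inf \<epsilon>"
    and outer: "pmm_iterates P \<tau> \<beta> \<epsilon> x y z k"
    and S: "S = pmm_sub P \<tau> \<beta> x y z k"
    and ssn_inputs: "0 < \<zeta>" "0 < \<mu>" "\<mu> < 1/2" "0 < \<delta>" "\<delta> < 1" "\<And>i. 0 < \<eta> i \<and> \<eta> i < 1"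
    and inner: "ssn_iterates S (\<epsilon> k) \<zeta> \<mu> \<delta> \<eta> xs ys j"
    and \<beta>NE: "\<beta>NE = lam_max (Sbar S \<zeta> (xs j) (ys j))"
    and \<alpha>H: "\<alpha>H = lam_min (Hbar S \<zeta> (xs j) (ys j))"
    and \<beta>H: "\<beta>H = lam_max (Hbar S \<zeta> (xs j) (ys j))"
  shows "spectrum (map_mat complex_of_real
            (minv (Mtil S \<zeta> (xs j) (ys j)) * Mhat S \<zeta> (xs j) (ys j)))
         \<subseteq> complex_of_real `
            ({- \<beta>H - sqrt \<beta>NE .. - \<alpha>H} \<union> {1 / (1 + \<beta>H) .. 1 + sqrt (\<beta>NE - 1)})"
proof -
  let ?x = "xs j" and ?y = "ys j"
  define n where "n = nvar P"
  define m where "m = ncon P"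
  define J where "J = Bset S \<zeta> ?x ?y"
  define p where "p = card J"
  have fields: "nvar S = n" "ncon S = m" "Qmat S = Qmat P" "Amat S = Amat P"
    "beta S = \<beta> k" "rho S = \<beta> k / \<tau> k"
    unfolding S pmm_sub_def n_def m_def by (cases P, simp add: qp.defs subproblem.defs)+
  have "\<beta> 0 \<le> \<beta> k" using inputs unfolding pmm_inputs_def by (auto dest: incseqD)
  hence \<beta>: "0 < \<beta> k" and \<tau>: "0 < \<tau> k" using inputs unfolding pmm_inputs_def by auto
  have Q: "sym_psd n (Qmat S)" and A: "Amat S \<in> carrier_mat m n"
    using problem unfolding qp_problem_def n_def m_def fields by auto
  have Qc: "Qmat S \<in> carrier_mat n n" using Q unfolding sym_psd_def by auto
  have J: "J \<subseteq> {..<n}" unfolding J_def Bset_def fields by auto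
  \<comment> \<open>The diagonal shift is \<open>1 / rho\<close> at indices inside the bounds and
    \<open>beta + 1 / rho\<close> elsewhere, positive either way, so \<open>H\<close> is definite
    although \<open>Q\<close> is only semidefinite.\<close>
  have "Hmat S ?x = Qmat S + mat_diag n (\<lambda>i. \<beta> k + inverse (\<beta> k / \<tau> k) - \<beta> k * (if inside S ?x i then 1 else 0))"
    unfolding Hmat_def Bmat_def fields(1,5,6) using Qc by (intro eq_matI) (auto simp: mat_diag_def)
  hence "sym_pd n (Hmat S ?x)" using sym_pd_add_mat_diag[OF Q] \<beta> \<tau> by (auto simp: divide_pos_pos add_pos_pos)
  hence H: "sym_pd p (H_BB S \<zeta> ?x ?y)"
    unfolding H_BB_def J_def[symmetric] p_def using sym_pd_principal_submatrix J by blast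
  define h where "h = (\<lambda>q. H_BB S \<zeta> ?x ?y $$ (q,q))"
  have h: "0 < h q" if "q < p" for q unfolding h_def by (rule sym_pd_diag_pos[OF H that])
  have Htil: "Htil S \<zeta> ?x ?y = mat_diag p h" unfolding Htil_def h_def p_def J_def ..
  have Ht: "sym_pd p (Htil S \<zeta> ?x ?y)" unfolding Htil by (rule sym_pd_mat_diag[OF h])
  have Hi: "minv (Htil S \<zeta> ?x ?y) = mat_diag p (\<lambda>q. inverse (h q))"
    unfolding Htil using h by (intro minv_mat_diag) force
  have AB: "A_B S \<zeta> ?x ?y \<in> carrier_mat m p"
  proof -
    have "{i. i < m \<and> i \<in> {..<m}} = {..<m}" "{i. i < n \<and> i \<in> J} = J" using J by auto
    thus ?thesis using A unfolding A_B_def J_def[symmetric] fields(2) p_def submatrix_def by auto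
  qed
  define f where "f = (\<lambda>q. if inside S ?x (pick J q) then inverse (h q) else 0)"
  \<comment> \<open>The entries of \<open>Emat\<close> are those of the inverse of
    \<open>Htil\<close> or zero. This places \<open>Stil\<close> between the regularisation
    \<open>\<kappa> I\<close> and \<open>Shat\<close>.\<close>
  have f: "0 \<le> f q" "f q \<le> inverse (h q)" if "q < p" for q using h[OF that] unfolding f_def by auto
  have E: "Emat S \<zeta> ?x ?y = mat_diag p f"
    unfolding Emat_def J_def[symmetric] p_def[symmetric] Htil unfolding mat_diag_def
    by (rule eq_matI) (auto simp: f_def)
  define \<kappa> where "\<kappa> = inverse (\<beta> k)"
  have \<kappa>: "0 < \<kappa>" using \<beta> \<kappa>_def by simp
  let ?A = "A_B S \<zeta> ?x ?y"
  have Stil: "Stil S \<zeta> ?x ?y = ?A * mat_diag p f * transpose_mat ?A + \<kappa> \<cdot>\<^sub>m 1\<^sub>m m"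
    unfolding Stil_def E fields \<kappa>_def ..
  have Shat: "Shat S \<zeta> ?x ?y = ?A * minv (Htil S \<zeta> ?x ?y) * transpose_mat ?A + \<kappa> \<cdot>\<^sub>m 1\<^sub>m m"
    unfolding Shat_def fields \<kappa>_def ..
  have Av: "transpose_mat ?A *\<^sub>v v \<in> carrier_vec p" if "v \<in> carrier_vec m" for v using AB that by auto
  \<comment> \<open>The forms of \<open>Stil\<close> and \<open>Shat\<close> are weighted sums of
    the same squares, so \<open>ge\<close> and \<open>le\<close> follow from comparing the weights
    termwise.\<close>
  have q: "v \<bullet> ((?A * mat_diag p g * transpose_mat ?A + \<kappa> \<cdot>\<^sub>m 1\<^sub>m m) *\<^sub>v v)
      = (\<Sum>i<p. g i * ((transpose_mat ?A *\<^sub>v v) $ i)\<^sup>2) + \<kappa> * (v \<bullet> v)" if v: "v \<in> carrier_vec m" for v g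
    using scalar_prod_normal_equation[OF AB v, of "mat_diag p g"] scalar_prod_mat_diag[OF Av[OF v]] by simp
  have ge: "\<kappa> * (v \<bullet> v) \<le> v \<bullet> (Stil S \<zeta> ?x ?y *\<^sub>v v)" if v: "v \<in> carrier_vec m" for v
    unfolding Stil q[OF v] using f by (auto intro!: sum_nonneg)
  have le: "v \<bullet> (Stil S \<zeta> ?x ?y *\<^sub>v v) \<le> v \<bullet> (Shat S \<zeta> ?x ?y *\<^sub>v v)" if v: "v \<in> carrier_vec m" for v
    unfolding Stil Shat Hi q[OF v] using f by (auto intro!: sum_mono mult_right_mono)
  have St: "sym_pd m (Stil S \<zeta> ?x ?y)"
  proof -
    have D: "mat_diag p f \<in> carrier_mat p p" and Dt: "transpose_mat (mat_diag p f) = mat_diag p f"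
      unfolding mat_diag_def by (auto intro!: eq_matI)
    have "0 < v \<bullet> (Stil S \<zeta> ?x ?y *\<^sub>v v)" if v: "v \<in> carrier_vec m" "v \<noteq> 0\<^sub>v m" for v
      using ge[OF v(1)] mult_pos_pos[OF \<kappa> scalar_prod_self_pos[OF v]] by simp
    moreover have "Stil S \<zeta> ?x ?y \<in> carrier_mat m m" unfolding Stil using AB by simp
    ultimately show ?thesis
      using transpose_normal_equation[OF AB D Dt] unfolding sym_pd_def Stil by simp
  qed
  show ?thesis
    unfolding Mtil_def Mhat_def J_def[symmetric] p_def[symmetric] fields \<kappa>_def[symmetric]
    by (rule preconditioned_saddle_point_spectrum[OF H Ht AB \<kappa> St ge Shat le
      Hbar_def Sbar_def \<alpha>H \<beta>H \<beta>NE])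
qed

end
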